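(* For all $n\ge1$, \[|\mathrm{Av}^\star_{3n}(132,213)|=|\mathrm{Av}^\star_{3n}(132,321)|=2\quad\text{and}\quad|\mathrm{Av}^\star_{3n}(132,231)|=|\mathrm{Av}^\star_{3n}(231,321)|=1.\] Moreover, if $\{\sigma,\tau\}$ is a pair of distinct patterns in $\mathcal{S}_3$ that cannot be obtained from any of the pairs $\{132,213\}$, $\{132,321\}$, $\{132,231\}$, $\{231,321\}$ by applying (to both patterns simultaneously) a composition of the operations of taking the inverse and taking the reverse-complement, then $|\mathrm{Av}^\star_{3n}(\sigma,\tau)|=0$ for all $n>2$.
   Context: Permutations are written in one-line notation $\pi=\pi_1\cdots\pi_m$; a permutation avoids $\sigma$ if no subsequence is in the same relative order as $\sigma$. $\mathcal{S}^\star_{3n}$ is the set of permutations of $[3n]$ whose cycle decomposition consists only of 3-cycles, and $\mathrm{Av}^\star_{3n}(\sigma,\tau)$ is the set of those avoiding both $\sigma$ and $\tau$. The inverse of a permutation is its group-theoretic inverse; the reverse-complement of $\pi\in\mathcal{S}_m$ is the permutation whose $i$-th entry is $m+1-\pi_{m+1-i}$. *)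

theory Defs
  imports "HOL-Combinatorics.Cycles"
begin

text \<open>
  A permutation of \<open>[m]\<close> is a function \<open>\<pi> :: nat \<Rightarrow> nat\<close> with \<open>\<pi> permutes {1..m}\<close>, so
  \<open>\<pi> i\<close> is the \<open>i\<close>-th entry of the one-line notation, for \<open>1 \<le> i \<le> m\<close>. As \<open>permutes\<close> forces
  \<open>\<pi>\<close> to be the identity outside \<open>{1..m}\<close>, each permutation is represented exactly once.
\<close>

definition one_line :: "nat list \<Rightarrow> nat \<Rightarrow> nat" where
  "one_line xs i = (if i \<in> {1..length xs} then xs ! (i - 1) else i)"

text \<open>Here \<open>\<pi>\<close> has length \<open>m\<close>, \<open>\<sigma>\<close> has length \<open>k\<close>, and \<open>f 1 < \<dots> < f k\<close> are the positions of the
  subsequence of \<open>\<pi>\<close> in the same relative order as \<open>\<sigma>\<close>.\<close>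

definition contains_pattern :: "nat \<Rightarrow> (nat \<Rightarrow> nat) \<Rightarrow> nat \<Rightarrow> (nat \<Rightarrow> nat) \<Rightarrow> bool" where
  "contains_pattern m \<pi> k \<sigma> \<longleftrightarrow>
     (\<exists>f. strict_mono_on {1..k} f \<and> f ` {1..k} \<subseteq> {1..m} \<and>
          (\<forall>i\<in>{1..k}. \<forall>j\<in>{1..k}. \<pi> (f i) < \<pi> (f j) \<longleftrightarrow> \<sigma> i < \<sigma> j))"

text \<open>Fixed points occur in the decomposition as cycles of length one, since the cycles
  are required to cover all of \<open>S\<close>.\<close>

definition is_cycle_decomposition :: "nat list list \<Rightarrow> nat set \<Rightarrow> (nat \<Rightarrow> nat) \<Rightarrow> bool" where
  "is_cycle_decomposition css S \<pi> \<longleftrightarrow>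
     [] \<notin> set css \<and> distinct (concat css) \<and> set (concat css) = S \<and>
     \<pi> = foldr (\<circ>) (map cycle_of_list css) id"

text \<open>The existential quantifier is harmless: the decomposition is unique up to the order
  of the cycles and the choice of their starting points, which do not affect lengths.\<close>

definition S_star :: "nat \<Rightarrow> (nat \<Rightarrow> nat) set" where
  "S_star m = {\<pi>. \<pi> permutes {1..m} \<and>
     (\<exists>css. is_cycle_decomposition css {1..m} \<pi> \<and> (\<forall>c\<in>set css. length c = 3))}"

definition Av_star :: "nat \<Rightarrow> (nat \<Rightarrow> nat) \<Rightarrow> (nat \<Rightarrow> nat) \<Rightarrow> (nat \<Rightarrow> nat) set" where
  "Av_star m \<sigma> \<tau> =
     {\<pi> \<in> S_star m. \<not> contains_pattern m \<pi> 3 \<sigma> \<and> \<not> contains_pattern m \<pi> 3 \<tau>}"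

lemma finite_Av_star: "finite (Av_star m \<sigma> \<tau>)"
  by (rule finite_subset[OF _ finite_permutations[of "{1..m}"]])
     (auto simp: Av_star_def S_star_def)

definition reverse_complement :: "nat \<Rightarrow> (nat \<Rightarrow> nat) \<Rightarrow> nat \<Rightarrow> nat" where
  "reverse_complement m \<pi> i = (if i \<in> {1..m} then m + 1 - \<pi> (m + 1 - i) else i)"

text \<open>All finite compositions, the empty one included, of the two operations on
  permutations of \<open>[m]\<close>.\<close>

inductive_set symmetries :: "nat \<Rightarrow> ((nat \<Rightarrow> nat) \<Rightarrow> nat \<Rightarrow> nat) set" for m where
  sym_id: "id \<in> symmetries m"
| sym_inverse: "g \<in> symmetries m \<Longrightarrow> inv \<circ> g \<in> symmetries m"
| sym_reverse_complement: "g \<in> symmetries m \<Longrightarrow> reverse_complement m \<circ> g \<in> symmetries m"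

end

theory Submission
  imports Defs
begin

text \<open>
  A permutation consists of 3-cycles iff it has no fixed points and its cube is the identity.
  Avoiding 132 together with 321 or 213 forces long runs of the form \<open>i \<mapsto> i + d\<close>, and the
  3-cycle condition leaves only the rotations by \<open>n\<close> and \<open>2n\<close>. Avoiding 132 and 231 means
  decreasing and then increasing; there each 3-cycle meets the increasing part exactly once.
  Avoiding 231 and 321 means that every entry has at most one larger entry before it, which
  forces the permutation to split off a block 312 again and again.

  For the remaining pairs, a 3-cycle is itself an occurrence of 231 or 312, and 123 and 321
  exclude each other by Erdos--Szekeres. For the others, up to reverse-complement, \<open>i + \<pi> i\<close>
  takes at most three values, which leaves room for two 3-cycles only.
\<close>

section \<open>Patterns of length three\<close>

text \<open>Avoidance only says how entries compare; explicit values come from counting. If the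
  positions from a to b carry exactly the values between two entries, the two intervals have equal
  length. This makes \<open>\<pi> i - i\<close> constant on an increasing run without gaps, and
  \<open>\<pi> i + i\<close> constant on a decreasing one. Most of the work therefore lies in
  showing that no value of a run is missing or placed elsewhere. The inverse is always written
  \<open>\<pi> (\<pi> v)\<close>, which the cube identity makes the position of the value v. So
  knowledge of where a value sits can be fed back into the description of the entries, and closing
  up a cycle relates the lengths of different runs.\<close>

lemma atLeastAtMost_1_3: "{1..3::nat} = {1,2,3}"
  by auto

text \<open>Neither \<pi> nor \<sigma> is assumed injective, so every comparison appears in both
  directions; for a concrete \<sigma> the six equivalences simplify to a chain of strict
  inequalities.\<close>

lemma contains_pattern_3:
  "contains_pattern m \<pi> 3 \<sigma> \<longleftrightarrow>
     (\<exists>i j k. 1 \<le> i \<and> i < j \<and> j < k \<and> k \<le> m \<and>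
        (\<pi> i < \<pi> j \<longleftrightarrow> \<sigma> 1 < \<sigma> 2) \<and> (\<pi> j < \<pi> i \<longleftrightarrow> \<sigma> 2 < \<sigma> 1) \<and>
        (\<pi> i < \<pi> k \<longleftrightarrow> \<sigma> 1 < \<sigma> 3) \<and> (\<pi> k < \<pi> i \<longleftrightarrow> \<sigma> 3 < \<sigma> 1) \<and>
        (\<pi> j < \<pi> k \<longleftrightarrow> \<sigma> 2 < \<sigma> 3) \<and> (\<pi> k < \<pi> j \<longleftrightarrow> \<sigma> 3 < \<sigma> 2))"
    (is "?L \<longleftrightarrow> ?R")
proof
  assume ?L
  then obtain f where "strict_mono_on {1..3} f" "f ` {1..3} \<subseteq> {1..m}"
    and ord: "\<forall>i\<in>{1..3}. \<forall>j\<in>{1..3}. \<pi> (f i) < \<pi> (f j) \<longleftrightarrow> \<sigma> i < \<sigma> j"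
    unfolding contains_pattern_def by blast
  then have "1 \<le> f 1" "f 1 < f 2" "f 2 < f 3" "f 3 \<le> m"
    by (simp_all add: strict_mono_on_def image_subset_iff)
  with ord show ?R
    unfolding atLeastAtMost_1_3
    by (intro exI[of _ "f 1"] exI[of _ "f 2"] exI[of _ "f 3"]) simp
next
  assume ?R
  then obtain i j k where ijk: "1 \<le> i" "i < j" "j < k" "k \<le> m"
    "\<pi> i < \<pi> j \<longleftrightarrow> \<sigma> 1 < \<sigma> 2" "\<pi> j < \<pi> i \<longleftrightarrow> \<sigma> 2 < \<sigma> 1"
    "\<pi> i < \<pi> k \<longleftrightarrow> \<sigma> 1 < \<sigma> 3" "\<pi> k < \<pi> i \<longleftrightarrow> \<sigma> 3 < \<sigma> 1"
    "\<pi> j < \<pi> k \<longleftrightarrow> \<sigma> 2 < \<sigma> 3" "\<pi> k < \<pi> j \<longleftrightarrow> \<sigma> 3 < \<sigma> 2"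
    by blast
  define f :: "nat \<Rightarrow> nat" where "f t = (if t = 1 then i else if t = 2 then j else k)" for t
  have "strict_mono_on {1..3} f"
    using ijk(1-4) by (auto simp: strict_mono_on_def atLeastAtMost_1_3 f_def)
  moreover have "f ` {1..3} \<subseteq> {1..m}"
    using ijk(1-4) by (auto simp: f_def)
  moreover have "\<forall>i\<in>{1..3}. \<forall>j\<in>{1..3}. \<pi> (f i) < \<pi> (f j) \<longleftrightarrow> \<sigma> i < \<sigma> j"
    unfolding atLeastAtMost_1_3 using ijk(5-) by (simp add: f_def)
  ultimately show ?L
    unfolding contains_pattern_def by blast
qed

lemma one_line_3:
  "one_line [a,b,c] i = (if i = 1 then a else if i = 2 then b else if i = 3 then c else i)"
proof -
  have "i \<in> {1..length [a,b,c]} \<longleftrightarrow> i = 1 \<or> i = 2 \<or> i = 3"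
    by auto
  then show ?thesis
    unfolding one_line_def by auto
qed

lemma contains_123:
  "contains_pattern m \<pi> 3 (one_line [1,2,3]) \<longleftrightarrow>
     (\<exists>i j k. 1 \<le> i \<and> i < j \<and> j < k \<and> k \<le> m \<and> \<pi> i < \<pi> j \<and> \<pi> j < \<pi> k)"
  unfolding contains_pattern_3 one_line_3 by (intro ex_cong1) auto

lemma contains_132:
  "contains_pattern m \<pi> 3 (one_line [1,3,2]) \<longleftrightarrow>
     (\<exists>i j k. 1 \<le> i \<and> i < j \<and> j < k \<and> k \<le> m \<and> \<pi> i < \<pi> k \<and> \<pi> k < \<pi> j)"
  unfolding contains_pattern_3 one_line_3 by (intro ex_cong1) auto

lemma contains_213:
  "contains_pattern m \<pi> 3 (one_line [2,1,3]) \<longleftrightarrow>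
     (\<exists>i j k. 1 \<le> i \<and> i < j \<and> j < k \<and> k \<le> m \<and> \<pi> j < \<pi> i \<and> \<pi> i < \<pi> k)"
  unfolding contains_pattern_3 one_line_3 by (intro ex_cong1) auto

lemma contains_231:
  "contains_pattern m \<pi> 3 (one_line [2,3,1]) \<longleftrightarrow>
     (\<exists>i j k. 1 \<le> i \<and> i < j \<and> j < k \<and> k \<le> m \<and> \<pi> k < \<pi> i \<and> \<pi> i < \<pi> j)"
  unfolding contains_pattern_3 one_line_3 by (intro ex_cong1) auto

lemma contains_312:
  "contains_pattern m \<pi> 3 (one_line [3,1,2]) \<longleftrightarrow>
     (\<exists>i j k. 1 \<le> i \<and> i < j \<and> j < k \<and> k \<le> m \<and> \<pi> j < \<pi> k \<and> \<pi> k < \<pi> i)"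
  unfolding contains_pattern_3 one_line_3 by (intro ex_cong1) auto

lemma contains_321:
  "contains_pattern m \<pi> 3 (one_line [3,2,1]) \<longleftrightarrow>
     (\<exists>i j k. 1 \<le> i \<and> i < j \<and> j < k \<and> k \<le> m \<and> \<pi> k < \<pi> j \<and> \<pi> j < \<pi> i)"
  unfolding contains_pattern_3 one_line_3 by (intro ex_cong1) auto

section \<open>Permutations composed of 3-cycles\<close>

text \<open>The set is a parameter because the two inductions relating this condition to cycle
  decompositions add or remove one cycle at a time.\<close>

definition fixfree_cube_id :: "'a set \<Rightarrow> ('a \<Rightarrow> 'a) \<Rightarrow> bool" where
  "fixfree_cube_id S \<pi> \<longleftrightarrow> \<pi> permutes S \<and> (\<forall>x\<in>S. \<pi> x \<noteq> x \<and> \<pi> (\<pi> (\<pi> x)) = x)"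

text \<open>Bijectivity comes for free: the cube condition makes \<open>\<pi> \<circ> \<pi>\<close>
  a two-sided inverse on S.\<close>

lemma fixfree_cube_idI:
  assumes "\<And>x. x \<in> S \<Longrightarrow> \<pi> x \<in> S" "\<And>x. x \<in> S \<Longrightarrow> \<pi> x \<noteq> x"
    and "\<And>x. x \<in> S \<Longrightarrow> \<pi> (\<pi> (\<pi> x)) = x" "\<And>x. x \<notin> S \<Longrightarrow> \<pi> x = x"
  shows "fixfree_cube_id S \<pi>"
proof -
  have "bij_betw \<pi> S S"
    by (rule bij_betw_byWitness[where f' = "\<pi> \<circ> \<pi>"]) (use assms in auto)
  then have "\<pi> permutes S"
    using assms(4) by (rule bij_imp_permutes)
  then show ?thesis
    using assms by (simp add: fixfree_cube_id_def)
qed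

lemma compose_3_cycles:
  assumes "distinct (concat css)" "\<forall>c\<in>set css. length c = 3"
  shows "fixfree_cube_id (set (concat css)) (foldr (\<circ>) (map cycle_of_list css) id)"
  using assms
proof (induction css)
  case Nil
  show ?case by (simp add: fixfree_cube_id_def permutes_def)
next
  case (Cons c css)
  then obtain x y z where c: "c = [x,y,z]"
    by (auto simp: length_Suc_conv numeral_3_eq_3)
  define \<rho> where "\<rho> = foldr (\<circ>) (map cycle_of_list css) id"
  have "distinct (concat css)" "\<forall>c\<in>set css. length c = 3"
    using Cons.prems by simp_all
  then have \<rho>: "fixfree_cube_id (set (concat css)) \<rho>"
    unfolding \<rho>_def by (rule Cons.IH)
  then have \<rho>_perm: "\<rho> permutes set (concat css)"
    unfolding fixfree_cube_id_def by (rule conjunct1)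
  note maps = permutes_in_image[OF \<rho>_perm]
  note unmoved = permutes_not_in[OF \<rho>_perm]
  have dist: "distinct [x,y,z]" "x \<notin> set (concat css)" "y \<notin> set (concat css)" "z \<notin> set (concat css)"
    using Cons.prems(1) c by auto
  \<comment> \<open>\<open>\<rho>\<close> acts first. It fixes x, y, z and keeps all other elements
    away from them, so the new cycle and \<open>\<rho>\<close> move disjoint sets.\<close>
  have eq: "(cycle_of_list c \<circ> \<rho>) i =
      (if i = x then y else if i = y then z else if i = z then x else \<rho> i)" for i
  proof (cases "i \<in> set (concat css)")
    case True
    with maps have "\<rho> i \<in> set (concat css)" by blast
    with True dist show ?thesis
      by (auto simp: c transpose_def)
  next
    case False
    with unmoved dist(1) show ?thesis
      by (auto simp: c transpose_def)
  qed
  have "fixfree_cube_id (set (concat (c # css))) (cycle_of_list c \<circ> \<rho>)"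
  proof (rule fixfree_cube_idI)
    fix i
    show "(cycle_of_list c \<circ> \<rho>) i \<in> set (concat (c # css))" if "i \<in> set (concat (c # css))"
      using that maps[of i] unfolding eq by (auto simp: c)
    show "(cycle_of_list c \<circ> \<rho>) i \<noteq> i" if "i \<in> set (concat (c # css))"
      using that \<rho> dist unfolding eq fixfree_cube_id_def by (auto simp: c)
    show "(cycle_of_list c \<circ> \<rho>) ((cycle_of_list c \<circ> \<rho>) ((cycle_of_list c \<circ> \<rho>) i)) = i"
      if "i \<in> set (concat (c # css))"
    proof (cases "i \<in> {x,y,z}")
      case True
      then show ?thesis using dist(1) unfolding eq by auto
    next
      case False
      then have "i \<in> set (concat css)" using that c by auto
      then have in_rest: "i \<in> set (concat css)" "\<rho> i \<in> set (concat css)" "\<rho> (\<rho> i) \<in> set (concat css)"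
        using maps by blast+
      then have "i \<notin> {x,y,z}" "\<rho> i \<notin> {x,y,z}" "\<rho> (\<rho> i) \<notin> {x,y,z}"
        using dist(2-) by blast+
      moreover have "\<rho> (\<rho> (\<rho> i)) = i"
        using \<rho> in_rest(1) unfolding fixfree_cube_id_def by blast
      ultimately show ?thesis
        unfolding eq by simp
    qed
    show "(cycle_of_list c \<circ> \<rho>) i = i" if "i \<notin> set (concat (c # css))"
      using that unmoved[of i] unfolding eq by (auto simp: c)
  qed
  then show ?case
    unfolding \<rho>_def list.map foldr.simps o_apply .
qed

text \<open>Peel off the orbit \<open>x, y, z\<close> of any element: \<pi>, made the identity on
  this orbit, satisfies the same condition on a proper subset of S.\<close>

lemma cycle_decomposition_3:
  assumes "finite S" "fixfree_cube_id S \<pi>"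
  shows "\<exists>css. distinct (concat css) \<and> set (concat css) = S \<and>
    \<pi> = foldr (\<circ>) (map cycle_of_list css) id \<and> (\<forall>c\<in>set css. length c = 3)"
  using assms
proof (induction S arbitrary: \<pi> rule: finite_psubset_induct)
  case (psubset S)
  note perm = psubset.prems[unfolded fixfree_cube_id_def]
  show ?case
  proof (cases "S = {}")
    case True
    then have "\<pi> = id" using perm by auto
    with True show ?thesis by (intro exI[of _ "[]"]) simp
  next
    case False
    then obtain x where x: "x \<in> S" by blast
    obtain y z where yz: "\<pi> x = y" "\<pi> y = z" by blast
    have cyc: "\<pi> z = x"
      using bspec[OF conjunct2[OF perm] x] unfolding yz by (rule conjunct2)
    have "y \<in> S"
      using permutes_in_image[OF conjunct1[OF perm], of x] x unfolding yz by (rule iffD2)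
    moreover from this have "z \<in> S"
      using permutes_in_image[OF conjunct1[OF perm], of y] unfolding yz by blast
    ultimately have in_S: "y \<in> S" "z \<in> S" .
    have dist: "x \<noteq> y" "y \<noteq> z" "z \<noteq> x"
      using bspec[OF conjunct2[OF perm] x] bspec[OF conjunct2[OF perm] in_S(1)]
        bspec[OF conjunct2[OF perm] in_S(2)]
      unfolding yz cyc by simp_all
    have inj: "\<pi> i = \<pi> j \<longleftrightarrow> i = j" for i j
      using permutes_inj[OF conjunct1[OF perm]] by (rule inj_eq)
    define \<rho> where "\<rho> i = (if i \<in> {x,y,z} then i else \<pi> i)" for i
    have avoid: "\<pi> i \<notin> {x,y,z}" if "i \<notin> {x,y,z}" for i
      using that inj[of i x] inj[of i y] inj[of i z] unfolding yz cyc by simp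
    have IH_prem: "fixfree_cube_id (S - {x,y,z}) \<rho>"
    proof (rule fixfree_cube_idI)
      fix i
      show "\<rho> i = i" if "i \<notin> S - {x,y,z}"
        using that perm permutes_not_in[of \<pi> S i] by (auto simp: \<rho>_def)
      assume i: "i \<in> S - {x,y,z}"
      with avoid have \<rho>: "\<rho> i = \<pi> i" "\<rho> (\<pi> i) = \<pi> (\<pi> i)" "\<rho> (\<pi> (\<pi> i)) = \<pi> (\<pi> (\<pi> i))"
        by (simp_all add: \<rho>_def)
      show "\<rho> i \<in> S - {x,y,z}"
        using i avoid[of i] perm permutes_in_image[of \<pi> S i] by (simp add: \<rho>)
      show "\<rho> i \<noteq> i" "\<rho> (\<rho> (\<rho> i)) = i"
        using i perm by (simp_all add: \<rho>)
    qed
    have "S - {x,y,z} \<subset> S" using x by blast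
    from psubset.IH[OF this IH_prem] obtain css where css: "distinct (concat css)" "set (concat css) = S - {x,y,z}"
      "\<rho> = foldr (\<circ>) (map cycle_of_list css) id" "\<forall>c\<in>set css. length c = 3"
      by blast
    have "\<pi> = cycle_of_list [x,y,z] \<circ> \<rho>"
    proof
      fix i
      show "\<pi> i = (cycle_of_list [x,y,z] \<circ> \<rho>) i"
      proof (cases "i \<in> {x,y,z}")
        case True
        then show ?thesis
          using dist by (auto simp: \<rho>_def transpose_def yz cyc)
      next
        case False
        with avoid[of i] show ?thesis by (simp add: \<rho>_def transpose_def)
      qed
    qed
    then have "\<pi> = foldr (\<circ>) (map cycle_of_list ([x,y,z] # css)) id"
      unfolding css(3) by simp
    moreover have "distinct (concat ([x,y,z] # css))"
      using css(1,2) dist by auto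
    moreover have "set (concat ([x,y,z] # css)) = S"
      using css(2) x in_S by auto
    moreover have "\<forall>c\<in>set ([x,y,z] # css). length c = 3"
      using css(4) by simp
    ultimately show ?thesis by blast
  qed
qed

lemma S_star_iff: "\<pi> \<in> S_star m \<longleftrightarrow> fixfree_cube_id {1..m} \<pi>"
proof
  assume "\<pi> \<in> S_star m"
  then obtain css where css: "is_cycle_decomposition css {1..m} \<pi>" "\<forall>c\<in>set css. length c = 3"
    unfolding S_star_def mem_Collect_eq by (elim conjE exE)
  then have "fixfree_cube_id (set (concat css)) (foldr (\<circ>) (map cycle_of_list css) id)"
    unfolding is_cycle_decomposition_def by (elim conjE) (rule compose_3_cycles)
  with css(1) show "fixfree_cube_id {1..m} \<pi>"
    unfolding is_cycle_decomposition_def by (elim conjE) (simp only:)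
next
  assume \<pi>: "fixfree_cube_id {1..m} \<pi>"
  obtain css where css: "distinct (concat css)" "set (concat css) = {1..m}"
    "\<pi> = foldr (\<circ>) (map cycle_of_list css) id" and len: "\<forall>c\<in>set css. length c = 3"
    using cycle_decomposition_3[OF finite_atLeastAtMost \<pi>] by (elim conjE exE)
  have "[] \<notin> set css" using len by force
  then have "is_cycle_decomposition css {1..m} \<pi>"
    unfolding is_cycle_decomposition_def by (intro conjI css)
  moreover have "\<pi> permutes {1..m}"
    using \<pi> unfolding fixfree_cube_id_def by (rule conjunct1)
  ultimately show "\<pi> \<in> S_star m"
    unfolding S_star_def mem_Collect_eq using len by (intro conjI exI)
qed

text \<open>A locale, since its facts are also applied to the inverse
  \<open>\<lambda>i. \<pi> (\<pi> i)\<close> and to the reverse-complement of \<pi>.\<close>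

locale three_cycles =
  fixes m :: nat and \<pi> :: "nat \<Rightarrow> nat"
  assumes fixfree_cube_id: "fixfree_cube_id {1..m} \<pi>"
begin

lemma perm: "\<pi> permutes {1..m}"
  using fixfree_cube_id by (simp add: fixfree_cube_id_def)

lemma outside: "i \<notin> {1..m} \<Longrightarrow> \<pi> i = i"
  using perm by (rule permutes_not_in)

lemma bounds: "1 \<le> i \<Longrightarrow> i \<le> m \<Longrightarrow> 1 \<le> \<pi> i \<and> \<pi> i \<le> m"
  using permutes_in_image[OF perm, of i] by auto

lemma inj [simp]: "\<pi> i = \<pi> j \<longleftrightarrow> i = j"
  using permutes_inj[OF perm] by (rule inj_eq)

lemma no_fix: "1 \<le> i \<Longrightarrow> i \<le> m \<Longrightarrow> \<pi> i \<noteq> i"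
  using fixfree_cube_id by (auto simp: fixfree_cube_id_def)

lemma cube [simp]: "\<pi> (\<pi> (\<pi> i)) = i"
proof (cases "i \<in> {1..m}")
  case True
  then show ?thesis using fixfree_cube_id unfolding fixfree_cube_id_def by blast
qed (simp add: outside)

lemma no_2_cycle: "1 \<le> i \<Longrightarrow> i \<le> m \<Longrightarrow> \<pi> (\<pi> i) \<noteq> i"
proof
  assume "1 \<le> i" "i \<le> m" "\<pi> (\<pi> i) = i"
  with cube[of i] no_fix[of i] show False by simp
qed

lemma position:
  assumes "1 \<le> v" "v \<le> m"
  obtains i where "1 \<le> i" "i \<le> m" "\<pi> i = v"
proof
  show "1 \<le> \<pi> (\<pi> v)" "\<pi> (\<pi> v) \<le> m"
    using bounds[OF assms] bounds[of "\<pi> v"] by simp_all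
qed simp

section \<open>Counting positions against values\<close>

lemma card_eq:
  assumes "A \<subseteq> {1..m}" "B \<subseteq> {1..m}" "\<And>i. 1 \<le> i \<Longrightarrow> i \<le> m \<Longrightarrow> i \<in> A \<longleftrightarrow> \<pi> i \<in> B"
  shows "card A = card B"
proof -
  have "\<pi> ` A = B"
  proof
    show "\<pi> ` A \<subseteq> B"
    proof (rule image_subsetI)
      fix i assume "i \<in> A"
      with assms(1) assms(3)[of i] show "\<pi> i \<in> B" by auto
    qed
    show "B \<subseteq> \<pi> ` A"
    proof
      fix v assume "v \<in> B"
      moreover from this have "1 \<le> v" "v \<le> m" using assms(2) by auto
      then obtain i where "1 \<le> i" "i \<le> m" "\<pi> i = v" by (rule position)
      ultimately show "v \<in> \<pi> ` A" using assms(3)[of i] by blast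
    qed
  qed
  moreover have "inj_on \<pi> A" by (simp add: inj_on_def)
  ultimately show ?thesis using card_image[of \<pi> A] by simp
qed

lemma interval_length:
  assumes "1 \<le> a" "b \<le> m" "1 \<le> c" "d \<le> m"
    and "\<And>i. 1 \<le> i \<Longrightarrow> i \<le> m \<Longrightarrow> a \<le> i \<and> i \<le> b \<longleftrightarrow> c \<le> \<pi> i \<and> \<pi> i \<le> d"
  shows "b + 1 - a = d + 1 - c"
proof -
  have "card {a..b} = card {c..d}"
    by (rule card_eq) (use assms in \<open>simp_all add: subset_iff\<close>)
  then show ?thesis by simp
qed

text \<open>The values strictly between \<open>\<pi> a\<close> and \<open>\<pi> b\<close> sit
  exactly at the positions strictly between a and b; counting both gives the equation, whatever the
  order inside. It expresses \<open>\<pi> b - b = \<pi> a - a\<close> without truncated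
  subtraction.\<close>

lemma increasing_run:
  assumes "1 \<le> a" "a \<le> b" "b \<le> m" "\<pi> a \<le> \<pi> b"
    and "\<And>x. a < x \<Longrightarrow> x < b \<Longrightarrow> \<pi> a < \<pi> x \<and> \<pi> x < \<pi> b"
    and "\<And>x. 1 \<le> x \<Longrightarrow> x < a \<Longrightarrow> \<not> (\<pi> a < \<pi> x \<and> \<pi> x < \<pi> b)"
    and "\<And>x. b < x \<Longrightarrow> x \<le> m \<Longrightarrow> \<not> (\<pi> a < \<pi> x \<and> \<pi> x < \<pi> b)"
  shows "\<pi> b + a = \<pi> a + b"
proof -
  have "b + 1 - a = \<pi> b + 1 - \<pi> a"
  proof (rule interval_length)
    fix x assume x: "1 \<le> x" "x \<le> m"
    consider "x = a \<or> x = b" | "a < x \<and> x < b" | "x < a" | "b < x"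
      by linarith
    then show "a \<le> x \<and> x \<le> b \<longleftrightarrow> \<pi> a \<le> \<pi> x \<and> \<pi> x \<le> \<pi> b"
    proof cases
      case 1
      then show ?thesis using assms(2,4) by auto
    next
      case 2
      then show ?thesis using assms(5)[of x] by auto
    next
      case 3
      then have "\<pi> x \<noteq> \<pi> a" "\<pi> x \<noteq> \<pi> b" using assms(2) by simp_all
      then show ?thesis using assms(6)[of x] 3 x by linarith
    next
      case 4
      then have "\<pi> x \<noteq> \<pi> a" "\<pi> x \<noteq> \<pi> b" using assms(2) by simp_all
      then show ?thesis using assms(7)[of x] 4 x by linarith
    qed
  qed (use assms(1-3) bounds[of a] bounds[of b] in auto)
  then show ?thesis using assms(2,4) by linarith
qed

text \<open>Here the conserved quantity is the sum of position and value.\<close>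

lemma decreasing_run:
  assumes "1 \<le> a" "a \<le> b" "b \<le> m" "\<pi> b \<le> \<pi> a"
    and "\<And>x. a < x \<Longrightarrow> x < b \<Longrightarrow> \<pi> b < \<pi> x \<and> \<pi> x < \<pi> a"
    and "\<And>x. 1 \<le> x \<Longrightarrow> x < a \<Longrightarrow> \<not> (\<pi> b < \<pi> x \<and> \<pi> x < \<pi> a)"
    and "\<And>x. b < x \<Longrightarrow> x \<le> m \<Longrightarrow> \<not> (\<pi> b < \<pi> x \<and> \<pi> x < \<pi> a)"
  shows "\<pi> a + a = \<pi> b + b"
proof -
  have "b + 1 - a = \<pi> a + 1 - \<pi> b"
  proof (rule interval_length)
    fix x assume x: "1 \<le> x" "x \<le> m"
    consider "x = a \<or> x = b" | "a < x \<and> x < b" | "x < a" | "b < x"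
      by linarith
    then show "a \<le> x \<and> x \<le> b \<longleftrightarrow> \<pi> b \<le> \<pi> x \<and> \<pi> x \<le> \<pi> a"
    proof cases
      case 1
      then show ?thesis using assms(2,4) by auto
    next
      case 2
      then show ?thesis using assms(5)[of x] by auto
    next
      case 3
      then have "\<pi> x \<noteq> \<pi> a" "\<pi> x \<noteq> \<pi> b" using assms(2) by simp_all
      then show ?thesis using assms(6)[of x] 3 x by linarith
    next
      case 4
      then have "\<pi> x \<noteq> \<pi> a" "\<pi> x \<noteq> \<pi> b" using assms(2) by simp_all
      then show ?thesis using assms(7)[of x] 4 x by linarith
    qed
  qed (use assms(1-3) bounds[of a] bounds[of b] in auto)
  then show ?thesis using assms(2,4) by linarith
qed

end

section \<open>Rotations\<close>

text \<open>For \<open>r \<le> m\<close> the one-line notation is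
  \<open>r+1, ..., m, 1, ..., r\<close>, the map adding r modulo m with representatives 1 to
  m.\<close>

definition rotation :: "nat \<Rightarrow> nat \<Rightarrow> nat \<Rightarrow> nat" where
  "rotation m r i = (if i \<in> {1..m} then if i \<le> m - r then i + r else i - (m - r) else i)"

lemma rotation_less_iff:
  assumes "1 \<le> i" "i < j" "j \<le> m" "r \<le> m"
  shows "rotation m r i < rotation m r j \<longleftrightarrow> m - r < i \<or> j \<le> m - r"
    and "rotation m r j < rotation m r i \<longleftrightarrow> i \<le> m - r \<and> m - r < j"
  using assms by (auto simp: rotation_def)

lemma fixfree_cube_id_rotation:
  assumes "1 \<le> n" "r = n \<or> r = 2 * n"
  shows "fixfree_cube_id {1..3 * n} (rotation (3 * n) r)"
  using assms by (intro fixfree_cube_idI) (auto simp: rotation_def)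

text \<open>An inversion must go from the first increasing run to the second. Hence there is no 321;
  an entry before the inversion exceeds its lower entry and an entry after it lies below its upper
  one, which excludes 132 and 213.\<close>

lemma rotation_avoids:
  assumes "r \<le> m"
  shows "\<not> contains_pattern m (rotation m r) 3 (one_line [1,3,2])"
    and "\<not> contains_pattern m (rotation m r) 3 (one_line [2,1,3])"
    and "\<not> contains_pattern m (rotation m r) 3 (one_line [3,2,1])"
  unfolding contains_132 contains_213 contains_321 using assms by (auto simp: rotation_less_iff)

section \<open>Permutations forced to be rotations\<close>

context three_cycles
begin

text \<open>Three rotations by r amount to one by \<open>3 * r\<close>, which must be a multiple of
  \<open>3 * n\<close>. The orbit of position 1 already shows this.\<close>

lemma rotation_amount:
  assumes "m = 3 * n" "1 \<le> n" "r < m" "\<pi> = rotation m r"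
  shows "r = n \<or> r = 2 * n"
proof -
  have "rotation m r 1 \<noteq> 1"
    using no_fix[of 1] assms by simp
  then have "0 < r"
    using assms(1-3) by (simp add: rotation_def split: if_splits)
  moreover have "rotation m r (rotation m r (rotation m r 1)) = 1"
    using cube[of 1] assms(4) by simp
  ultimately show ?thesis
    using assms(1-3) by (auto simp: rotation_def split: if_splits)
qed

text \<open>Entries below \<open>\<pi> 1\<close> increase by avoidance of 321, those above it by
  avoidance of 132. What remains is that the high entries form an initial segment.\<close>

lemma avoids_132_321_imp_rotation:
  assumes "1 \<le> m" "\<not> contains_pattern m \<pi> 3 (one_line [1,3,2])"
    "\<not> contains_pattern m \<pi> 3 (one_line [3,2,1])"
  shows "\<exists>r<m. \<pi> = rotation m r"
proof -
  have no132: "\<not> (\<pi> i < \<pi> k \<and> \<pi> k < \<pi> j)" and no321: "\<not> (\<pi> k < \<pi> j \<and> \<pi> j < \<pi> i)"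
    if "1 \<le> i" "i < j" "j < k" "k \<le> m" for i j k
    using assms(2,3) that unfolding contains_132 contains_321 by blast+
  have first: "1 \<le> \<pi> 1" "\<pi> 1 \<le> m" "1 < \<pi> 1"
    using bounds[of 1] no_fix[of 1] assms(1) by auto
  \<comment> \<open>Otherwise the value m, which is not at position m for lack of fixed points,
    stands strictly between the first and the last position and completes a 132.\<close>
  have last: "\<pi> m < \<pi> 1"
  proof (rule ccontr)
    assume "\<not> \<pi> m < \<pi> 1"
    obtain p where p: "1 \<le> p" "p \<le> m" "\<pi> p = m"
      using position[OF assms(1)] by blast
    have "\<pi> m \<noteq> m" "\<pi> m \<le> m" using no_fix[of m] bounds[of m] assms(1) by auto
    then have "\<pi> m < m" "p \<noteq> m" using p by auto
    moreover have "\<pi> 1 \<noteq> \<pi> m" "p \<noteq> 1"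
      using first no_fix[of 1] \<open>\<pi> m < m\<close> \<open>\<not> \<pi> m < \<pi> 1\<close> p by auto
    ultimately show False
      using no132[of 1 p m] p \<open>\<not> \<pi> m < \<pi> 1\<close> by linarith
  qed
  \<comment> \<open>If a low position j precedes a high position i, compare \<open>\<pi> j\<close>
    with \<open>\<pi> m\<close>: either 1, j, m form a 321 or j, i, m form a 132.\<close>
  have high_before_low: "i < j" if "1 \<le> i" "i \<le> m" "1 \<le> j" "j \<le> m" "\<pi> 1 \<le> \<pi> i" "\<pi> j < \<pi> 1" for i j
  proof (rule ccontr)
    assume "\<not> i < j"
    moreover have "i \<noteq> m" using that(5) last by (intro notI) simp
    moreover have "j \<noteq> 1" using that(6) by (intro notI) simp
    moreover have "j \<noteq> i" using that(5,6) by (intro notI) simp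
    ultimately have "j < i" "j < m" "i < m" "1 < j" using that by linarith+
    then show False
      using no132[of j i m] no321[of 1 j m] last that inj[of j m] by linarith
  qed
  have high: "\<pi> i + 1 = \<pi> 1 + i" if i: "1 \<le> i" "i \<le> m" "\<pi> 1 \<le> \<pi> i" for i
  proof (rule increasing_run)
    fix x
    show "\<pi> 1 < \<pi> x \<and> \<pi> x < \<pi> i" if x: "1 < x" "x < i"
    proof -
      have "\<pi> 1 \<noteq> \<pi> i" "\<pi> x \<noteq> \<pi> 1" "\<pi> x \<noteq> \<pi> i" using x by simp_all
      moreover have "\<not> \<pi> x < \<pi> 1" using high_before_low[of i x] i x by linarith
      ultimately show ?thesis using no132[of 1 x i] i x by linarith
    qed
    show "\<not> (\<pi> 1 < \<pi> x \<and> \<pi> x < \<pi> i)" if "i < x" "x \<le> m"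
      using no132[of 1 i x] i that by (cases "i = 1") auto
  qed (use i in auto)
  have low_increasing: "\<pi> i < \<pi> j" if "1 \<le> i" "i < j" "j \<le> m" "\<pi> i < \<pi> 1" for i j
  proof (cases "i = 1")
    case False
    moreover have "\<pi> i \<noteq> \<pi> j" using that by simp
    ultimately show ?thesis using no321[of 1 i j] that by linarith
  qed (use that in simp)
  \<comment> \<open>The low entries increase, so the largest of them, \<open>\<pi> 1 - 1\<close>,
    comes last.\<close>
  have last_eq: "\<pi> m + 1 = \<pi> 1"
  proof -
    obtain q where q: "1 \<le> q" "q \<le> m" "\<pi> q = \<pi> 1 - 1"
      by (rule position[of "\<pi> 1 - 1"]) (use first in auto)
    then have "\<not> q < m" using low_increasing[of q m] last first by linarith
    then have "q = m" using q by simp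
    then show ?thesis using q first by simp
  qed
  have low: "\<pi> m + i = \<pi> i + m" if i: "1 \<le> i" "i \<le> m" "\<pi> i < \<pi> 1" for i
  proof (rule increasing_run)
    show "\<pi> i \<le> \<pi> m" using low_increasing[of i m] i by (cases "i = m") auto
    fix x
    show "\<pi> i < \<pi> x \<and> \<pi> x < \<pi> m" if x: "i < x" "x < m"
    proof -
      have "\<pi> x < \<pi> 1"
        using high_before_low[of x i] i x by linarith
      then show ?thesis using low_increasing[of i x] low_increasing[of x m] i x by simp
    qed
    show "\<not> (\<pi> i < \<pi> x \<and> \<pi> x < \<pi> m)" if "1 \<le> x" "x < i"
      using low_increasing[of x i] last i that by (cases "\<pi> x < \<pi> 1") auto
  qed (use i in auto)
  have "\<pi> i = rotation m (\<pi> 1 - 1) i" for i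
  proof (cases "i \<in> {1..m}")
    case True
    then have i: "1 \<le> i" "i \<le> m" by auto
    show ?thesis
    proof (cases "\<pi> 1 \<le> \<pi> i")
      case True
      then show ?thesis
        using high[of i] first bounds[of i] i unfolding rotation_def by auto
    next
      case False
      then show ?thesis
        using low[of i] last_eq first bounds[of i] i unfolding rotation_def by auto
    qed
  qed (auto simp: outside rotation_def)
  then have "\<pi> = rotation m (\<pi> 1 - 1)" by (rule ext)
  moreover have "\<pi> 1 - 1 < m" using first by simp
  ultimately show ?thesis by (intro exI conjI)
qed

text \<open>The cycle through 1 gives \<open>\<pi> (d + 1) = e + 1\<close>, the downward shift gives
  \<open>d + 1 - e\<close>; hence \<open>d = 2 * e\<close>. Positions above e take the values up to
  \<open>m - e\<close>, so the first e positions take the top e values. These exceed d: otherwise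
  the downward shift would bring one of them into the first e positions, whose entries are again at
  the top, and its cycle could not close. The upward shift then carries e to m.\<close>

lemma two_shifts:
  assumes "\<pi> 1 = d + 1" "\<pi> (e + 1) = 1" "1 \<le> e" "e \<le> d" "d < m" "e < m"
    and up: "\<And>i. 1 \<le> i \<Longrightarrow> i \<le> m \<Longrightarrow> d < \<pi> i \<Longrightarrow> \<pi> i = i + d"
    and down: "\<And>i. 1 \<le> i \<Longrightarrow> i \<le> m \<Longrightarrow> e < i \<Longrightarrow> i = \<pi> i + e"
  shows "d + e = m"
proof -
  have "d + 1 = \<pi> (d + 1) + e"
    using down[of "d + 1"] assms(4,5) by simp
  moreover have "\<pi> (\<pi> (d + 1)) = 1"
    using cube[of 1] unfolding assms(1) .
  then have "\<pi> (d + 1) = e + 1"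
    using inj[of "\<pi> (d + 1)" "e + 1"] assms(2) by simp
  ultimately have d: "d = 2 * e" by simp
  have beyond: "m - e < \<pi> i" if i: "1 \<le> i" "i \<le> e" for i
  proof (rule ccontr)
    assume "\<not> m - e < \<pi> i"
    moreover have "1 \<le> \<pi> i" using bounds[of i] i assms(6) by simp
    ultimately have "1 \<le> \<pi> i + e" "\<pi> i + e \<le> m" "e < \<pi> i + e"
      using assms(6) by linarith+
    then have "\<pi> (\<pi> i + e) = \<pi> i"
      using down[of "\<pi> i + e"] by linarith
    then show False using i \<open>1 \<le> \<pi> i\<close> by simp
  qed
  have up': "\<pi> i = i + d" if i: "1 \<le> i" "i \<le> e" for i
  proof (rule up)
    show "d < \<pi> i"
    proof (rule ccontr)
      assume "\<not> d < \<pi> i"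
      have "m - e < \<pi> i" "\<pi> i \<le> m" using beyond[OF i] bounds[of i] i assms(6) by auto
      moreover from this have "\<pi> i = \<pi> (\<pi> i) + e"
        using down[of "\<pi> i"] d assms(5) by linarith
      moreover have "1 \<le> \<pi> (\<pi> i)" using calculation bounds[of "\<pi> i"] by linarith
      ultimately have "m - e < \<pi> (\<pi> (\<pi> i))"
        using beyond[of "\<pi> (\<pi> i)"] \<open>\<not> d < \<pi> i\<close> d by linarith
      then show False using i d assms(5) by simp
    qed
  qed (use i assms(6) in auto)
  obtain p where p: "1 \<le> p" "p \<le> m" "\<pi> p = m"
    by (rule position[of m]) (use assms(6) in auto)
  show ?thesis
    using up[of p] down[of p] up'[of e] bounds[of e] p assms(3,5,6) by linarith
qed

text \<open>Inversion exchanges positions and values, hence d and e in \<open>two_shifts\<close>;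
  this supplies the case \<open>d < e\<close>.\<close>

lemma three_cycles_inverse: "three_cycles m (\<lambda>i. \<pi> (\<pi> i))"
proof
  show "fixfree_cube_id {1..m} (\<lambda>i. \<pi> (\<pi> i))"
  proof (rule fixfree_cube_idI)
    fix i assume "i \<in> {1..m}"
    then show "\<pi> (\<pi> i) \<in> {1..m}" "\<pi> (\<pi> i) \<noteq> i"
      using bounds[of i] bounds[of "\<pi> i"] no_2_cycle[of i] by auto
  qed (simp_all add: outside)
qed

text \<open>The entries from \<open>\<pi> 1\<close> upwards and the entries from the value 1 onwards
  form increasing runs without gaps. Avoidance alone leaves room for further runs between them; the
  3-cycle condition makes these two cover everything.\<close>

lemma avoids_132_213_imp_rotation:
  assumes "1 \<le> m" "\<not> contains_pattern m \<pi> 3 (one_line [1,3,2])"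
    "\<not> contains_pattern m \<pi> 3 (one_line [2,1,3])"
  shows "\<exists>r<m. \<pi> = rotation m r"
proof -
  have no132: "\<not> (\<pi> i < \<pi> k \<and> \<pi> k < \<pi> j)" and no213: "\<not> (\<pi> j < \<pi> i \<and> \<pi> i < \<pi> k)"
    if "1 \<le> i" "i < j" "j < k" "k \<le> m" for i j k
    using assms(2,3) that unfolding contains_132 contains_213 by blast+
  \<comment> \<open>\<open>d\<close> counts the values below the first entry, \<open>e\<close> the
    positions before the value 1, which sits at \<open>\<pi> (\<pi> 1)\<close>.\<close>
  define d where "d = \<pi> 1 - 1"
  define e where "e = \<pi> (\<pi> 1) - 1"
  have de: "\<pi> 1 = d + 1" "\<pi> (d + 1) = e + 1" "\<pi> (e + 1) = 1" "d < m" "e < m" "1 \<le> d" "1 \<le> e"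
    using bounds[of 1] bounds[of "\<pi> 1"] no_fix[of 1] no_2_cycle[of 1] cube[of 1] assms(1)
    by (auto simp: d_def e_def)
  have up: "\<pi> i = i + d" if i: "1 \<le> i" "i \<le> m" "d < \<pi> i" for i
  proof -
    have "\<pi> i + 1 = \<pi> 1 + i"
    proof (rule increasing_run)
      fix x
      show "\<pi> 1 < \<pi> x \<and> \<pi> x < \<pi> i" if x: "1 < x" "x < i"
      proof -
        have "\<pi> 1 \<noteq> \<pi> i" "\<pi> x \<noteq> \<pi> 1" "\<pi> x \<noteq> \<pi> i" using x by simp_all
        then show ?thesis using no132[of 1 x i] no213[of 1 x i] i x de(1) by linarith
      qed
      show "\<not> (\<pi> 1 < \<pi> x \<and> \<pi> x < \<pi> i)" if "i < x" "x \<le> m"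
        using no132[of 1 i x] i that by (cases "i = 1") auto
    qed (use i de(1) in auto)
    then show ?thesis using de(1) by simp
  qed
  have down: "i = \<pi> i + e" if i: "1 \<le> i" "i \<le> m" "e < i" for i
  proof -
    have "\<pi> i + (e + 1) = \<pi> (e + 1) + i"
    proof (rule increasing_run)
      show "\<pi> (e + 1) \<le> \<pi> i" using de(3) bounds[of i] i by simp
      fix x
      show "\<pi> (e + 1) < \<pi> x \<and> \<pi> x < \<pi> i" if x: "e + 1 < x" "x < i"
      proof -
        have "\<pi> (e + 1) \<noteq> \<pi> i" "\<pi> x \<noteq> \<pi> (e + 1)" "\<pi> x \<noteq> \<pi> i" using x by simp_all
        then show ?thesis using no132[of "e + 1" x i] i x de(3) bounds[of i] bounds[of x] by linarith
      qed
      show "\<not> (\<pi> (e + 1) < \<pi> x \<and> \<pi> x < \<pi> i)" if "i < x" "x \<le> m"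
        using no132[of "e + 1" i x] i that by (cases "i = e + 1") auto
      show "\<not> (\<pi> (e + 1) < \<pi> x \<and> \<pi> x < \<pi> i)" if "1 \<le> x" "x < e + 1"
        using no213[of x "e + 1" i] i that by (cases "i = e + 1") auto
    qed (use i in auto)
    then show ?thesis using de(3) by simp
  qed
  have sum: "d + e = m"
  proof (cases "e \<le> d")
    case True
    show ?thesis
      by (rule two_shifts[OF de(1,3,7) True de(4,5) up down])
  next
    case False
    interpret inverse: three_cycles m "\<lambda>i. \<pi> (\<pi> i)"
      by (rule three_cycles_inverse)
    have "e + d = m"
    proof (rule inverse.two_shifts)
      fix i assume i: "1 \<le> i" "i \<le> m"
      show "\<pi> (\<pi> i) = i + e" if "e < \<pi> (\<pi> i)"
        using down[of "\<pi> (\<pi> i)"] that bounds[of i] bounds[of "\<pi> i"] i by simp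
      show "i = \<pi> (\<pi> i) + d" if "d < i"
        using up[of "\<pi> (\<pi> i)"] that bounds[of i] bounds[of "\<pi> i"] i by simp
    qed (use False de in auto)
    then show ?thesis by simp
  qed
  have "\<pi> i = rotation m d i" for i
  proof (cases "i \<in> {1..m}")
    case True
    show ?thesis
    proof (cases "e < i")
      case True
      then show ?thesis using down[of i] sum \<open>i \<in> {1..m}\<close> unfolding rotation_def by auto
    next
      case False
      \<comment> \<open>As \<open>d + e = m\<close>, the positions above e already use up all values
        up to d.\<close>
      have "d < \<pi> i"
      proof (rule ccontr)
        assume "\<not> d < \<pi> i"
        then have "\<pi> (\<pi> i + e) = \<pi> i"
          using down[of "\<pi> i + e"] bounds[of i] True sum by auto
        then show False using False bounds[of i] True by simp
      qed
      then show ?thesis using up[of i] False sum True unfolding rotation_def by auto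
    qed
  qed (auto simp: outside rotation_def)
  then have "\<pi> = rotation m d" by (rule ext)
  with de(4) show ?thesis by (intro exI conjI)
qed

end

lemma card_rotations:
  assumes "1 \<le> n"
  shows "card {rotation (3 * n) n, rotation (3 * n) (2 * n)} = 2"
proof -
  have "rotation (3 * n) n 1 \<noteq> rotation (3 * n) (2 * n) 1"
    using assms by (simp add: rotation_def)
  then have "rotation (3 * n) n \<noteq> rotation (3 * n) (2 * n)" by metis
  then show ?thesis by simp
qed

lemma Av_star_132_213:
  assumes "1 \<le> n"
  shows "Av_star (3 * n) (one_line [1,3,2]) (one_line [2,1,3])
    = {rotation (3 * n) n, rotation (3 * n) (2 * n)}" (is "?A = ?B")
proof
  show "?A \<subseteq> ?B"
  proof
    fix \<pi> assume \<pi>: "\<pi> \<in> ?A"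
    then interpret three_cycles "3 * n" \<pi>
      by unfold_locales (simp add: Av_star_def S_star_iff)
    obtain r where "r < 3 * n" "\<pi> = rotation (3 * n) r"
      using avoids_132_213_imp_rotation assms \<pi> by (auto simp: Av_star_def)
    then show "\<pi> \<in> ?B" using rotation_amount[OF refl assms] by blast
  qed
  show "?B \<subseteq> ?A"
    using assms fixfree_cube_id_rotation[of n] rotation_avoids[of _ "3 * n"]
    by (auto simp: Av_star_def S_star_iff)
qed

lemma Av_star_132_321:
  assumes "1 \<le> n"
  shows "Av_star (3 * n) (one_line [1,3,2]) (one_line [3,2,1])
    = {rotation (3 * n) n, rotation (3 * n) (2 * n)}" (is "?A = ?B")
proof
  show "?A \<subseteq> ?B"
  proof
    fix \<pi> assume \<pi>: "\<pi> \<in> ?A"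
    then interpret three_cycles "3 * n" \<pi>
      by unfold_locales (simp add: Av_star_def S_star_iff)
    obtain r where "r < 3 * n" "\<pi> = rotation (3 * n) r"
      using avoids_132_321_imp_rotation assms \<pi> by (auto simp: Av_star_def)
    then show "\<pi> \<in> ?B" using rotation_amount[OF refl assms] by blast
  qed
  show "?B \<subseteq> ?A"
    using assms fixfree_cube_id_rotation[of n] rotation_avoids[of _ "3 * n"]
    by (auto simp: Av_star_def S_star_iff)
qed

section \<open>Valleys\<close>

text \<open>In one-line notation \<open>3n, ..., 2n+1, n, ..., 1, n+1, ..., 2n\<close>; the cycles
  are \<open>i, 3n+1-i, 2n+1-i\<close> for \<open>1 \<le> i \<le> n\<close>.\<close>

definition valley :: "nat \<Rightarrow> nat \<Rightarrow> nat" where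
  "valley n i = (if i \<in> {1..3 * n} then
     if i \<le> n then 3 * n + 1 - i else if i \<le> 2 * n then 2 * n + 1 - i else i - n
   else i)"

lemma fixfree_cube_id_valley: "fixfree_cube_id {1..3 * n} (valley n)"
  by (rule fixfree_cube_idI) (auto simp: valley_def)

text \<open>132 and 231 are the two patterns with the largest entry in the middle, so both are
  excluded at once.\<close>

lemma valley_no_peak:
  assumes "1 \<le> i" "i < j" "j < k" "k \<le> 3 * n"
  shows "\<not> (valley n i < valley n j \<and> valley n k < valley n j)"
  using assms by (auto simp: valley_def)

lemma valley_avoids:
  "\<not> contains_pattern (3 * n) (valley n) 3 (one_line [1,3,2])"
  "\<not> contains_pattern (3 * n) (valley n) 3 (one_line [2,3,1])"
  unfolding contains_132 contains_231 using valley_no_peak less_trans by blast+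

lemma (in three_cycles) avoids_132_231_imp_valley:
  assumes m: "m = 3 * n" "1 \<le> n" and "\<not> contains_pattern m \<pi> 3 (one_line [1,3,2])"
    "\<not> contains_pattern m \<pi> 3 (one_line [2,3,1])"
  shows "\<pi> = valley n"
proof -
  have no132: "\<not> (\<pi> i < \<pi> k \<and> \<pi> k < \<pi> j)" and no231: "\<not> (\<pi> k < \<pi> i \<and> \<pi> i < \<pi> j)"
    if "1 \<le> i" "i < j" "j < k" "k \<le> m" for i j k
    using assms(3,4) that unfolding contains_132 contains_231 by blast+
  have no_peak: "\<not> (\<pi> i < \<pi> j \<and> \<pi> k < \<pi> j)" if "1 \<le> i" "i < j" "j < k" "k \<le> m" for i j k
  proof -
    have "\<pi> i \<noteq> \<pi> k" using that by simp
    then show ?thesis using no132[OF that] no231[OF that] by linarith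
  qed
  obtain p where p: "1 \<le> p" "p \<le> m" "\<pi> p = m"
    by (rule position[of m]) (use m in auto)
  \<comment> \<open>Without peaks the largest value stands at an end, and m is not a fixed
    point.\<close>
  have top: "\<pi> 1 = m"
  proof (cases "p = 1")
    case False
    have "p \<noteq> m" using no_fix[of m] p by auto
    then have "1 < p" "p < m" "\<pi> 1 \<noteq> \<pi> p" "\<pi> m \<noteq> \<pi> p"
      using p(1,2) False inj[of 1 p] inj[of m p] by auto
    moreover have "\<pi> 1 \<le> m" "\<pi> m \<le> m" using bounds[of 1] bounds[of m] m by simp_all
    ultimately show ?thesis using no_peak[of 1 p m] p(3) by linarith
  qed (use p in simp)
  \<comment> \<open>The cycle through 1 is \<open>1, m, c\<close>, so c is both the last entry and
    the position of the minimum.\<close>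
  obtain c where c: "\<pi> m = c" by simp
  have bottom: "\<pi> c = 1"
    using cube[of 1] unfolding top c .
  have c_bounds: "1 < c" "c < m"
    using bounds[of m] no_fix[of m] no_2_cycle[of m] c bottom top m by (auto simp: le_less)
  have left: "\<pi> j < \<pi> i" if "1 \<le> i" "i < j" "j \<le> c" for i j
  proof -
    have neq: "\<pi> i \<noteq> \<pi> j" "\<pi> i \<noteq> \<pi> c" "1 \<le> \<pi> i" "1 \<le> \<pi> j"
      using that c_bounds bounds[of i] bounds[of j] by simp_all
    show ?thesis
    proof (cases "j = c")
      case True
      then have "\<pi> j = 1" using bottom by simp
      then show ?thesis using neq by linarith
    next
      case False
      then have "j < c" "\<pi> j \<noteq> \<pi> c" using that by simp_all
      then show ?thesis using no_peak[of i j c] neq that c_bounds bottom by linarith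
    qed
  qed
  have right: "\<pi> i < \<pi> j" if "c \<le> i" "i < j" "j \<le> m" for i j
  proof -
    have neq: "\<pi> i \<noteq> \<pi> j" "\<pi> j \<noteq> \<pi> c" "1 \<le> \<pi> i" "1 \<le> \<pi> j"
      using that c_bounds bounds[of i] bounds[of j] by simp_all
    show ?thesis
    proof (cases "i = c")
      case True
      then have "\<pi> i = 1" using bottom by simp
      then show ?thesis using neq by linarith
    next
      case False
      then have "c < i" "\<pi> i \<noteq> \<pi> c" using that by simp_all
      then show ?thesis using no_peak[of c i j] neq that c_bounds bottom by linarith
    qed
  qed
  have right_le: "\<pi> i \<le> c" if "c < i" "i \<le> m" for i
    using right[of i m] that c by (cases "i = m") auto
  \<comment> \<open>Values above c exceed every entry of the increasing part, so they fill the
    beginning of the decreasing part.\<close>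
  have high: "\<pi> i + i = m + 1" if i: "1 \<le> i" "i \<le> m" "c < \<pi> i" for i
  proof -
    have "i \<le> c" using right_le[of i] i by linarith
    have "\<pi> 1 + 1 = \<pi> i + i"
    proof (rule decreasing_run)
      show "\<pi> i \<le> \<pi> 1" using bounds[of i] i top by simp
      fix x
      show "\<pi> i < \<pi> x \<and> \<pi> x < \<pi> 1" if "1 < x" "x < i"
        using left[of 1 x] left[of x i] that \<open>i \<le> c\<close> by simp
      show "\<not> (\<pi> i < \<pi> x \<and> \<pi> x < \<pi> 1)" if "i < x" "x \<le> m"
        using left[of i x] right_le[of x] i that by (cases "x \<le> c") auto
    qed (use i in auto)
    then show ?thesis using top by simp
  qed
  have initial: "\<pi> i = m + 1 - i" if i: "1 \<le> i" "i \<le> m - c" for i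
  proof -
    obtain q where q: "1 \<le> q" "q \<le> m" "\<pi> q = m + 1 - i"
      by (rule position[of "m + 1 - i"]) (use i in auto)
    then have "q = i" using high[of q] i c_bounds by linarith
    then show ?thesis using q by simp
  qed
  \<comment> \<open>The positions right of the minimum form the middle third of each 3-cycle, since the
    decreasing part left of it cannot contain a whole 3-cycle.\<close>
  have middle_third: "c < i \<longleftrightarrow> m - c < \<pi> i \<and> \<pi> i \<le> c" if i: "1 \<le> i" "i \<le> m" for i
  proof
    assume "c < i"
    moreover have "m - c < \<pi> i"
    proof (rule ccontr)
      assume "\<not> m - c < \<pi> i"
      then have "\<pi> (\<pi> i) = m + 1 - \<pi> i" using initial[of "\<pi> i"] bounds[of i] i by simp
      then have "c < \<pi> (\<pi> i)" "\<pi> (\<pi> i) \<le> m"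
        using \<open>\<not> m - c < \<pi> i\<close> c_bounds bounds[of i] i by linarith+
      then show False using right_le[of "\<pi> (\<pi> i)"] \<open>c < i\<close> by simp
    qed
    ultimately show "m - c < \<pi> i \<and> \<pi> i \<le> c" using right_le i by blast
  next
    assume y: "m - c < \<pi> i \<and> \<pi> i \<le> c"
    show "c < i"
    proof (rule ccontr)
      assume "\<not> c < i"
      obtain y z where yz: "\<pi> i = y" "\<pi> y = z" by simp
      have "\<pi> z = i" using cube[of i] unfolding yz .
      have b: "1 \<le> y" "y \<le> m" "1 \<le> z" "z \<le> m"
        using bounds[of i] bounds[of y] i yz by auto
      have "z \<le> c"
        using high[of y] y yz b c_bounds by linarith
      have "i \<noteq> y" using no_fix[of i] i yz by auto
      \<comment> \<open>With i, y and z all in the decreasing part, \<pi> would reverse the order of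
        a three-element set and fix its middle element.\<close>
      then show False
        using left[of i y] left[of y i] left[of y z] left[of z y] left[of i z] left[of z i]
          i b yz y \<open>\<pi> z = i\<close> \<open>z \<le> c\<close> \<open>\<not> c < i\<close> by linarith
    qed
  qed
  \<comment> \<open>Counting both sides of \<open>middle_third\<close> gives
    \<open>m - c = 2c - m\<close>, that is, \<open>3c = 2m\<close>.\<close>
  have "m + 1 - (c + 1) = c + 1 - (m - c + 1)"
  proof (rule interval_length)
    fix x assume "1 \<le> x" "x \<le> m"
    then show "c + 1 \<le> x \<and> x \<le> m \<longleftrightarrow> m - c + 1 \<le> \<pi> x \<and> \<pi> x \<le> c"
      using middle_third[of x] by auto
  qed (use c_bounds in auto)
  then have n: "c = 2 * n" "m - c = n"
    using c_bounds m by linarith+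
  have middle: "\<pi> i + i = 2 * n + 1" if i: "n < i" "i \<le> 2 * n" for i
  proof -
    have "\<pi> i \<le> n"
      using middle_third[of i] high[of i] i n m by linarith
    have "\<pi> i + i = \<pi> c + c"
    proof (rule decreasing_run)
      show "\<pi> c \<le> \<pi> i" using bounds[of i] i n m bottom by simp
      fix x
      show "\<pi> c < \<pi> x \<and> \<pi> x < \<pi> i" if "i < x" "x < c"
        using left[of i x] left[of x c] that i by simp
      show "\<not> (\<pi> c < \<pi> x \<and> \<pi> x < \<pi> i)" if "1 \<le> x" "x < i"
        using left[of x i] that i n by simp
      show "\<not> (\<pi> c < \<pi> x \<and> \<pi> x < \<pi> i)" if "c < x" "x \<le> m"
        using middle_third[of x] that \<open>\<pi> i \<le> n\<close> n by simp
    qed (use i n c_bounds in auto)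
    then show ?thesis using bottom n by simp
  qed
  \<comment> \<open>The first two thirds are known; the last third is read off by closing each
    cycle.\<close>
  have final: "\<pi> i = i - n" if i: "2 * n < i" "i \<le> m" for i
  proof -
    have "\<pi> (i - n) = m + 1 - i"
      using middle[of "i - n"] i m by linarith
    moreover have "\<pi> (m + 1 - i) = i"
      using initial[of "m + 1 - i"] i m n by simp
    ultimately show ?thesis
      using cube[of "i - n"] by simp
  qed
  have "\<pi> i = valley n i" for i
  proof (cases "i \<in> {1..m}")
    case True
    consider "i \<le> n" | "n < i" "i \<le> 2 * n" | "2 * n < i" by linarith
    then show ?thesis
    proof cases
      case 1
      with True n m initial[of i] show ?thesis by (simp add: valley_def)
    next
      case 2
      with True n m middle[of i] show ?thesis by (simp add: valley_def)
    next
      case 3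
      with True n m final[of i] show ?thesis by (simp add: valley_def)
    qed
  next
    case False
    with m outside[of i] show ?thesis by (auto simp: valley_def)
  qed
  then show ?thesis by (rule ext)
qed

lemma Av_star_132_231:
  assumes "1 \<le> n"
  shows "Av_star (3 * n) (one_line [1,3,2]) (one_line [2,3,1]) = {valley n}" (is "?A = ?B")
proof
  show "?A \<subseteq> ?B"
  proof
    fix \<pi> assume \<pi>: "\<pi> \<in> ?A"
    then interpret three_cycles "3 * n" \<pi>
      by unfold_locales (simp add: Av_star_def S_star_iff)
    show "\<pi> \<in> ?B"
      using avoids_132_231_imp_valley[OF refl assms] \<pi> by (auto simp: Av_star_def)
  qed
  show "?B \<subseteq> ?A"
    using fixfree_cube_id_valley valley_avoids by (auto simp: Av_star_def S_star_iff)
qed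

section \<open>Direct sums of 3-cycles\<close>

text \<open>The block 312 repeated without an upper bound, so that the same function describes ever
  longer prefixes during an induction.\<close>

definition shift_block :: "nat \<Rightarrow> nat" where
  "shift_block i = (if i mod 3 = 1 then i + 2 else i - 1)"

definition block_sum :: "nat \<Rightarrow> nat \<Rightarrow> nat" where
  "block_sum n i = (if i \<in> {1..3 * n} then shift_block i else i)"

lemma shift_block_simps:
  "shift_block (3 * k + 1) = 3 * k + 3"
  "shift_block (3 * k + 2) = 3 * k + 1"
  "shift_block (3 * k + 3) = 3 * k + 2"
  unfolding shift_block_def by presburger+

lemma shift_block_cube:
  assumes "1 \<le> i"
  shows "shift_block (shift_block (shift_block i)) = i"
proof -
  have "\<exists>k. i = 3 * k + 1 \<or> i = 3 * k + 2 \<or> i = 3 * k + 3"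
    using assms by presburger
  then obtain k where "i = 3 * k + 1 \<or> i = 3 * k + 2 \<or> i = 3 * k + 3" ..
  then show ?thesis
    by (elim disjE) (simp_all only: shift_block_simps)
qed

lemma shift_block_in:
  assumes "1 \<le> i" "i \<le> 3 * n"
  shows "1 \<le> shift_block i" "shift_block i \<le> 3 * n"
  using assms unfolding shift_block_def by presburger+

lemma fixfree_cube_id_block_sum: "fixfree_cube_id {1..3 * n} (block_sum n)"
proof (rule fixfree_cube_idI)
  fix i assume i: "i \<in> {1..3 * n}"
  then show "block_sum n i \<in> {1..3 * n}"
    using shift_block_in[of i n] by (simp add: block_sum_def)
  show "block_sum n i \<noteq> i"
    using i by (auto simp: block_sum_def shift_block_def)
  have "shift_block (shift_block (shift_block i)) = i"
    using i by (intro shift_block_cube) simp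
  then show "block_sum n (block_sum n (block_sum n i)) = i"
    using i shift_block_in[of i n] shift_block_in[of "shift_block i" n] by (simp add: block_sum_def)
qed (auto simp: block_sum_def)

lemma block_sum_avoids:
  "\<not> contains_pattern (3 * n) (block_sum n) 3 (one_line [2,3,1])"
  "\<not> contains_pattern (3 * n) (block_sum n) 3 (one_line [3,2,1])"
proof -
  have "\<not> (block_sum n k < block_sum n i \<and> block_sum n k < block_sum n j)"
    if ijk: "1 \<le> i" "i < j" "j < k" "k \<le> 3 * n" for i j k
  proof -
    have "block_sum n i = shift_block i" "block_sum n j = shift_block j" "block_sum n k = shift_block k"
      using ijk by (simp_all add: block_sum_def)
    moreover have "\<not> (shift_block k < shift_block i \<and> shift_block k < shift_block j)"
    proof
      assume less: "shift_block k < shift_block i \<and> shift_block k < shift_block j"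
      \<comment> \<open>Only an entry raised by 2 can exceed \<open>k - 1\<close> with two positions
        to go until k. So i starts a block that ends in k, and the middle entry of that block is too
        small.\<close>
      have "k - 1 \<le> shift_block k" by (auto simp: shift_block_def)
      then have "k - 1 < shift_block i" using less by simp
      then have "i mod 3 = 1" "j = i + 1" "k = i + 2"
        using ijk by (auto simp: shift_block_def split: if_splits)
      then have "j mod 3 = 2" by presburger
      then have "shift_block j = j - 1" by (simp add: shift_block_def)
      with less \<open>k - 1 \<le> shift_block k\<close> ijk show False by auto
    qed
    ultimately show ?thesis by simp
  qed
  then show "\<not> contains_pattern (3 * n) (block_sum n) 3 (one_line [2,3,1])"
    "\<not> contains_pattern (3 * n) (block_sum n) 3 (one_line [3,2,1])"
    unfolding contains_231 contains_321 using less_trans by blast+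
qed

text \<open>The induction is over prefixes, so n is separate from m. A known prefix is mapped to
  itself, and the cube identity keeps later positions from taking its values; the next cycle
  \<open>s, a, b\<close> is then pinned down by where the smallest remaining values stand.\<close>

lemma (in three_cycles) avoids_231_321_imp_shift_block:
  assumes "\<not> contains_pattern m \<pi> 3 (one_line [2,3,1])"
    "\<not> contains_pattern m \<pi> 3 (one_line [3,2,1])"
    and "3 * n \<le> m" "1 \<le> i" "i \<le> 3 * n"
  shows "\<pi> i = shift_block i"
  using assms(3-5)
proof (induction n arbitrary: i)
  case (Suc n)
  have no_two_larger: "\<not> (\<pi> k < \<pi> i \<and> \<pi> k < \<pi> j)" if "1 \<le> i" "i < j" "j < k" "k \<le> m" for i j k
  proof -
    have "\<not> (\<pi> k < \<pi> i \<and> \<pi> i < \<pi> j)" "\<not> (\<pi> k < \<pi> j \<and> \<pi> j < \<pi> i)"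
      using assms(1,2) that unfolding contains_231 contains_321 by blast+
    moreover have "\<pi> i \<noteq> \<pi> j" using that by simp
    ultimately show ?thesis by linarith
  qed
  have IH: "\<pi> j = shift_block j" if "1 \<le> j" "j \<le> 3 * n" for j
    using Suc.IH Suc.prems(1) that by simp
  have large: "3 * n < \<pi> j" if j: "3 * n < j" "j \<le> m" for j
  proof (rule ccontr)
    assume "\<not> 3 * n < \<pi> j"
    moreover have "1 \<le> \<pi> j" using bounds[of j] j by simp
    ultimately have "1 \<le> \<pi> (\<pi> j)" "\<pi> (\<pi> j) \<le> 3 * n"
      using IH[of "\<pi> j"] shift_block_in[of "\<pi> j" n] by auto
    then have "\<pi> (\<pi> (\<pi> j)) \<le> 3 * n"
      using IH[of "\<pi> (\<pi> j)"] shift_block_in[of "\<pi> (\<pi> j)" n] by auto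
    then show False using j by simp
  qed
  obtain s where s: "s = 3 * n + 1" by simp
  obtain a where a: "\<pi> s = a" by simp
  have s_le: "s + 2 \<le> m" using Suc.prems(1) s by simp
  have a_bounds: "s < a" "a \<le> m"
    using large[of s] no_fix[of s] bounds[of s] s s_le a by auto
  obtain b where b: "\<pi> a = b" by simp
  have "\<pi> b = s" using cube[of s] unfolding a b .
  have b_bounds: "s < b" "b \<le> m"
    using large[of a] bounds[of a] no_2_cycle[of s] a b a_bounds s s_le by auto
  \<comment> \<open>Position b holds the smallest remaining value s; if b came later, positions s
    and \<open>s + 1\<close> would both hold larger entries before it.\<close>
  have "b = s + 1"
  proof (rule ccontr)
    assume "b \<noteq> s + 1"
    then have "s + 1 < b" using b_bounds by simp
    moreover from this have "\<pi> (s + 1) \<noteq> \<pi> b" by simp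
    moreover have "s \<le> \<pi> (s + 1)" using large[of "s + 1"] s s_le by simp
    ultimately show False
      using no_two_larger[of s "s + 1" b] \<open>\<pi> b = s\<close> a a_bounds b_bounds s by linarith
  qed
  \<comment> \<open>Position a holds the next value \<open>s + 1\<close>; if a came later, positions
    s and \<open>s + 2\<close> would both hold larger entries before it.\<close>
  have "a = s + 2"
  proof (rule ccontr)
    assume "a \<noteq> s + 2"
    moreover have "a \<noteq> s + 1" using no_fix[of a] a_bounds b \<open>b = s + 1\<close> by auto
    ultimately have "s + 2 < a" using a_bounds by simp
    moreover from this have "\<pi> (s + 2) \<noteq> \<pi> a" "\<pi> (s + 2) \<noteq> \<pi> b" using \<open>b = s + 1\<close> by simp_all
    moreover have "s \<le> \<pi> (s + 2)" using large[of "s + 2"] s s_le by simp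
    ultimately show False
      using no_two_larger[of s "s + 2" a] \<open>\<pi> b = s\<close> a b \<open>b = s + 1\<close> a_bounds s by linarith
  qed
  consider "i \<le> 3 * n" | "i = s" | "i = s + 1" | "i = s + 2"
    using Suc.prems(3) s by fastforce
  then show ?case
  proof cases
    case 1
    then show ?thesis using IH Suc.prems(2) by blast
  next
    case 2
    then show ?thesis using a \<open>a = s + 2\<close> s by (simp add: shift_block_def)
  next
    case 3
    then have "i mod 3 = 2" using s by presburger
    with 3 show ?thesis using \<open>\<pi> b = s\<close> \<open>b = s + 1\<close> by (simp add: shift_block_def)
  next
    case 4
    then have "i mod 3 = 0" using s by presburger
    with 4 show ?thesis using b \<open>b = s + 1\<close> \<open>a = s + 2\<close> by (simp add: shift_block_def)
  qed
qed simp

lemma Av_star_231_321: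
  "Av_star (3 * n) (one_line [2,3,1]) (one_line [3,2,1]) = {block_sum n}" (is "?A = ?B")
proof
  show "?A \<subseteq> ?B"
  proof
    fix \<pi> assume \<pi>: "\<pi> \<in> ?A"
    then interpret three_cycles "3 * n" \<pi>
      by unfold_locales (simp add: Av_star_def S_star_iff)
    have "\<pi> i = block_sum n i" for i
    proof (cases "i \<in> {1..3 * n}")
      case True
      then show ?thesis
        using avoids_231_321_imp_shift_block[of n i] \<pi> by (simp add: Av_star_def block_sum_def)
    next
      case False
      then show ?thesis using outside[of i] by (auto simp: block_sum_def)
    qed
    then have "\<pi> = block_sum n" by (rule ext)
    then show "\<pi> \<in> ?B" by simp
  qed
  show "?B \<subseteq> ?A"
    using fixfree_cube_id_block_sum block_sum_avoids by (auto simp: Av_star_def S_star_iff)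
qed

section \<open>Pairs that cannot be avoided\<close>

context three_cycles
begin

lemma contains_231_or_312:
  assumes "1 \<le> m"
  shows "contains_pattern m \<pi> 3 (one_line [2,3,1]) \<or> contains_pattern m \<pi> 3 (one_line [3,1,2])"
proof -
  obtain a b where ab: "\<pi> 1 = a" "\<pi> a = b" by simp
  have "\<pi> b = 1" using cube[of 1] unfolding ab .
  have bounds: "1 < a" "a \<le> m" "1 < b" "b \<le> m"
    using bounds[of 1] bounds[of a] no_fix[of 1] no_2_cycle[of 1] ab assms by (auto simp: le_less)
  have "a \<noteq> b" using no_fix[of a] ab bounds by auto
  then consider "a < b" | "b < a" by linarith
  then show ?thesis
  proof cases
    case 1
    then have "contains_pattern m \<pi> 3 (one_line [2,3,1])"
      unfolding contains_231 using ab \<open>\<pi> b = 1\<close> bounds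
      by (intro exI[of _ 1] exI[of _ a] exI[of _ b]) simp
    then show ?thesis ..
  next
    case 2
    then have "contains_pattern m \<pi> 3 (one_line [3,1,2])"
      unfolding contains_312 using ab \<open>\<pi> b = 1\<close> bounds
      by (intro exI[of _ 1] exI[of _ b] exI[of _ a]) simp
    then show ?thesis ..
  qed
qed

text \<open>The order of the first two entries forces the next three to lie on one side of
  \<open>\<pi> 2\<close>, and then to be monotone.\<close>

lemma contains_123_or_321:
  assumes "5 \<le> m"
  shows "contains_pattern m \<pi> 3 (one_line [1,2,3]) \<or> contains_pattern m \<pi> 3 (one_line [3,2,1])"
proof (rule ccontr)
  assume avoids: "\<not> ?thesis"
  have no123: "\<not> (\<pi> i < \<pi> j \<and> \<pi> j < \<pi> k)" and no321: "\<not> (\<pi> k < \<pi> j \<and> \<pi> j < \<pi> i)"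
    if "1 \<le> i" "i < j" "j < k" "k \<le> m" for i j k
    using avoids that unfolding contains_123 contains_321 by blast+
  have neq: "\<pi> 1 \<noteq> \<pi> 2" "\<pi> 2 \<noteq> \<pi> 3" "\<pi> 2 \<noteq> \<pi> 4" "\<pi> 2 \<noteq> \<pi> 5" "\<pi> 3 \<noteq> \<pi> 4" "\<pi> 4 \<noteq> \<pi> 5"
    by simp_all
  then consider "\<pi> 1 < \<pi> 2" | "\<pi> 2 < \<pi> 1" by linarith
  then show False
  proof cases
    case 1
    then have "\<pi> 3 < \<pi> 2" "\<pi> 4 < \<pi> 2" "\<pi> 5 < \<pi> 2"
      using no123[of 1 2 3] no123[of 1 2 4] no123[of 1 2 5] neq assms by linarith+
    then have "\<pi> 3 < \<pi> 4" "\<pi> 4 < \<pi> 5"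
      using no321[of 2 3 4] no321[of 2 4 5] neq assms by linarith+
    then show False using no123[of 3 4 5] assms by linarith
  next
    case 2
    then have "\<pi> 2 < \<pi> 3" "\<pi> 2 < \<pi> 4" "\<pi> 2 < \<pi> 5"
      using no321[of 1 2 3] no321[of 1 2 4] no321[of 1 2 5] neq assms by linarith+
    then have "\<pi> 4 < \<pi> 3" "\<pi> 5 < \<pi> 4"
      using no123[of 2 3 4] no123[of 2 4 5] neq assms by linarith+
    then show False using no321[of 3 4 5] assms by linarith
  qed
qed

text \<open>The values of \<open>i + \<pi> i\<close> along a 3-cycle are distinct, so if only three values are
  available then they and their order along the cycle determine the cycle. There are two
  cyclic orders.\<close>

lemma three_sums_imp_le_6:
  assumes "\<And>i. 1 \<le> i \<Longrightarrow> i \<le> m \<Longrightarrow> \<pi> i + i = A \<or> \<pi> i + i = B \<or> \<pi> i + i = C"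
  shows "m \<le> 6"
proof -
  \<comment> \<open>If the sums of consecutive elements of a cycle starting at x are A, B, C in this
    order, then \<open>2x = A + C - B\<close>; in the order A, C, B, \<open>2x = A + B - C\<close>.
    So a cycle whose first sum is A must start at u or v.\<close>
  define u where "u = (A + C - B) div 2"
  define v where "v = (A + B - C) div 2"
  have "i \<in> set [u, \<pi> u, \<pi> (\<pi> u), v, \<pi> v, \<pi> (\<pi> v)]" if i: "1 \<le> i" "i \<le> m" for i
  proof -
    obtain y z where yz: "\<pi> i = y" "\<pi> y = z" by simp
    have "\<pi> z = i" using cube[of i] unfolding yz .
    have b: "1 \<le> y" "y \<le> m" "1 \<le> z" "z \<le> m"
      using bounds[of i] bounds[of y] i yz by auto
    have "i \<noteq> y" "y \<noteq> z" "z \<noteq> i"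
      using no_fix[of i] no_fix[of y] no_fix[of z] i b yz \<open>\<pi> z = i\<close> by auto
    have vals: "i + y = A \<or> i + y = B \<or> i + y = C" "y + z = A \<or> y + z = B \<or> y + z = C"
        "z + i = A \<or> z + i = B \<or> z + i = C"
      using assms[of i] assms[of y] assms[of z] i b unfolding yz \<open>\<pi> z = i\<close> by linarith+
    have distinct_sums: "i + y \<noteq> y + z" "y + z \<noteq> z + i" "z + i \<noteq> i + y"
      using \<open>i \<noteq> y\<close> \<open>y \<noteq> z\<close> \<open>z \<noteq> i\<close> by linarith+
    have rearrange: "r = A \<and> (s = B \<and> t = C \<or> s = C \<and> t = B) \<or>
        s = A \<and> (t = B \<and> r = C \<or> t = C \<and> r = B) \<or> t = A \<and> (r = B \<and> s = C \<or> r = C \<and> s = B)"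
      if "r = A \<or> r = B \<or> r = C" "s = A \<or> s = B \<or> s = C" "t = A \<or> t = B \<or> t = C"
        "r \<noteq> s" "s \<noteq> t" "t \<noteq> r" for r s t
      using that by (elim disjE) simp_all
    have start: "x = u \<or> x = v"
      if "x + x' = A \<and> (x' + x'' = B \<and> x'' + x = C \<or> x' + x'' = C \<and> x'' + x = B)" for x x' x''
      using that unfolding u_def v_def by auto
    have "i = u \<or> i = v \<or> y = u \<or> y = v \<or> z = u \<or> z = v"
      using rearrange[OF vals distinct_sums] start[of i y z] start[of y z i] start[of z i y]
      by linarith
    moreover have "i = \<pi> (\<pi> y)" "i = \<pi> z" using yz \<open>\<pi> z = i\<close> by simp_all
    ultimately show ?thesis by auto
  qed
  then have "{1..m} \<subseteq> set [u, \<pi> u, \<pi> (\<pi> u), v, \<pi> v, \<pi> (\<pi> v)]"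
    unfolding subset_iff atLeastAtMost_iff by blast
  then have "card {1..m} \<le> card (set [u, \<pi> u, \<pi> (\<pi> u), v, \<pi> v, \<pi> (\<pi> v)])"
    by (rule card_mono[OF finite_set])
  also have "\<dots> \<le> 6" using card_length[of "[u, \<pi> u, \<pi> (\<pi> u), v, \<pi> v, \<pi> (\<pi> v)]"] by simp
  finally show ?thesis by simp
qed

text \<open>The average of \<open>i + \<pi> i\<close> is \<open>m + 1\<close>, while three distinct values that are at least \<open>m\<close>
  have an average of at least \<open>m + 1\<close>, with equality only for \<open>m\<close>, \<open>m + 1\<close> and \<open>m + 2\<close>.\<close>

lemma sums_ge_imp_le_6:
  assumes ge: "\<And>i. 1 \<le> i \<Longrightarrow> i \<le> m \<Longrightarrow> m \<le> \<pi> i + i"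
  shows "m \<le> 6"
proof (rule three_sums_imp_le_6)
  \<comment> \<open>\<open>T i\<close> adds the three sums along the cycle of i. They are distinct
    and at least m, so \<open>T i\<close> is at least \<open>m + (m + 1) + (m + 2)\<close>; its
    average over all i is exactly this.\<close>
  define T where "T i = 2 * i + 2 * \<pi> i + 2 * \<pi> (\<pi> i)" for i
  have along_cycle: "m \<le> \<pi> i + i \<and> m \<le> \<pi> (\<pi> i) + \<pi> i \<and> m \<le> i + \<pi> (\<pi> i) \<and>
    i \<noteq> \<pi> i \<and> \<pi> i \<noteq> \<pi> (\<pi> i) \<and> \<pi> (\<pi> i) \<noteq> i" if i: "1 \<le> i" "i \<le> m" for i
    using ge[of i] ge[of "\<pi> i"] ge[of "\<pi> (\<pi> i)"] no_fix[of i] no_2_cycle[of i]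
      bounds[of i] bounds[of "\<pi> i"] i by auto
  have T_ge: "3 * m + 3 \<le> T i" if "i \<in> {1..m}" for i
    using along_cycle[of i] that unfolding T_def atLeastAtMost_iff by linarith
  have sum_\<pi>: "(\<Sum>i\<in>{1..m}. g (\<pi> i)) = (\<Sum>i\<in>{1..m}. g i)" for g :: "nat \<Rightarrow> nat"
    using sum.permute[OF perm, of g] by (simp add: o_def)
  have "(\<Sum>i\<in>{1..m}. T i) = 2 * \<Sum>{1..m} + 2 * (\<Sum>i\<in>{1..m}. \<pi> i) + 2 * (\<Sum>i\<in>{1..m}. \<pi> (\<pi> i))"
    unfolding T_def sum.distrib sum_distrib_left ..
  also have "\<dots> = 3 * (2 * \<Sum>{1..m})"
    using sum_\<pi>[of "\<lambda>i. i"] sum_\<pi>[of \<pi>] by simp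
  also have "2 * \<Sum>{1..m} = m * (m + 1)"
    using gauss_sum_from_Suc_0[of m, where 'a = nat] by simp
  finally have sum_T: "(\<Sum>i\<in>{1..m}. T i) = (\<Sum>i\<in>{1..m}. 3 * m + 3)"
    by (simp add: algebra_simps)
  have T_eq: "T i = 3 * m + 3" if "i \<in> {1..m}" for i
  proof (rule ccontr)
    assume "T i \<noteq> 3 * m + 3"
    then have "3 * m + 3 < T i" using T_ge[OF that] by simp
    then have "(\<Sum>i\<in>{1..m}. 3 * m + 3) < (\<Sum>i\<in>{1..m}. T i)"
      using T_ge that by (intro sum_strict_mono_ex1) auto
    then show False using sum_T by simp
  qed
  fix i assume "1 \<le> i" "i \<le> m"
  then show "\<pi> i + i = m \<or> \<pi> i + i = m + 1 \<or> \<pi> i + i = m + 2"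
    using along_cycle[of i] T_eq[of i] unfolding T_def atLeastAtMost_iff by linarith
qed

text \<open>Avoiding both means that at most one larger entry follows each entry. Of the
  \<open>m - \<pi> i\<close> larger values at most \<open>i - 1\<close> stand before i, so
  \<open>m \<le> \<pi> i + i\<close>.\<close>

lemma contains_123_or_132:
  assumes "6 < m"
  shows "contains_pattern m \<pi> 3 (one_line [1,2,3]) \<or> contains_pattern m \<pi> 3 (one_line [1,3,2])"
proof (rule ccontr)
  assume avoids: "\<not> ?thesis"
  have one_larger: "\<not> (\<pi> i < \<pi> j \<and> \<pi> i < \<pi> k)" if "1 \<le> i" "i < j" "j < k" "k \<le> m" for i j k
  proof -
    have "\<not> (\<pi> i < \<pi> j \<and> \<pi> j < \<pi> k)" "\<not> (\<pi> i < \<pi> k \<and> \<pi> k < \<pi> j)"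
      using avoids that unfolding contains_123 contains_132 by blast+
    moreover have "\<pi> j \<noteq> \<pi> k" using that by simp
    ultimately show ?thesis by linarith
  qed
  have "m \<le> \<pi> i + i" if i: "1 \<le> i" "i \<le> m" for i
  proof -
    define L where "L = {x \<in> {i<..m}. \<pi> i < \<pi> x}"
    have "finite L" by (simp add: L_def)
    have "x = y" if "x \<in> L" "y \<in> L" for x y
      using one_larger[of i x y] one_larger[of i y x] that i unfolding L_def
      by (cases x y rule: linorder_cases) auto
    then have "card L \<le> 1" using card_le_Suc0_iff_eq[OF \<open>finite L\<close>] by auto
    have "card {x \<in> {1..m}. \<pi> i < \<pi> x} = card {\<pi> i<..m}"
      by (rule card_eq) (use bounds in auto)
    then have "m - \<pi> i = card {x \<in> {1..m}. \<pi> i < \<pi> x}" by simp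
    also have "\<dots> \<le> card ({1..<i} \<union> L)"
      by (rule card_mono) (auto simp: L_def not_less le_less)
    also have "\<dots> \<le> (i - 1) + card L"
      using card_Un_le[of "{1..<i}" L] by simp
    finally show ?thesis using \<open>card L \<le> 1\<close> i by linarith
  qed
  then have "m \<le> 6" by (rule sums_ge_imp_le_6)
  then show False using assms by simp
qed

text \<open>Let p and q be the positions of m and 1. Entries above \<open>\<pi> 1\<close> decrease
  and cannot precede p. The low entries before p continue a decreasing run from position 1, those
  after p form one that ends with the value 1. The constant sums \<open>p + m\<close>,
  \<open>\<pi> 1 + 1\<close> and \<open>q + 1\<close> are read off at p, 1 and q.\<close>

lemma contains_123_or_312:
  assumes "6 < m"
  shows "contains_pattern m \<pi> 3 (one_line [1,2,3]) \<or> contains_pattern m \<pi> 3 (one_line [3,1,2])"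
proof (rule ccontr)
  assume avoids: "\<not> ?thesis"
  have no123: "\<not> (\<pi> i < \<pi> j \<and> \<pi> j < \<pi> k)" and no312: "\<not> (\<pi> j < \<pi> k \<and> \<pi> k < \<pi> i)"
    if "1 \<le> i" "i < j" "j < k" "k \<le> m" for i j k
    using avoids that unfolding contains_123 contains_312 by blast+
  obtain p where p: "1 \<le> p" "p \<le> m" "\<pi> p = m"
    by (rule position[of m]) (use assms in auto)
  obtain q where q: "1 \<le> q" "q \<le> m" "\<pi> q = 1"
    by (rule position[of 1]) (use assms in auto)
  have "q \<noteq> 1" using no_fix[of 1] q assms by auto
  have below: "\<pi> x < m" if "1 \<le> x" "x \<le> m" "x \<noteq> p" for x
    using bounds[of x] inj[of x p] p that by auto
  have above: "1 < \<pi> x" if "1 \<le> x" "x \<le> m" "x \<noteq> q" for x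
    using bounds[of x] inj[of x q] q that by (auto simp: le_less)
  have high_ge: "p \<le> j" if "1 < j" "j \<le> m" "\<pi> 1 < \<pi> j" for j
    using no123[of 1 j p] below[of j] that p by linarith
  have high: "\<pi> j + j = p + m" if j: "1 < j" "j \<le> m" "\<pi> 1 < \<pi> j" for j
  proof -
    have "\<pi> p + p = \<pi> j + j"
    proof (rule decreasing_run)
      show "p \<le> j" using high_ge j by blast
      show "\<pi> j \<le> \<pi> p" using bounds[of j] j p by simp
      fix x
      show "\<pi> j < \<pi> x \<and> \<pi> x < \<pi> p" if "p < x" "x < j"
      proof -
        have "\<pi> x \<noteq> \<pi> j" using that by simp
        then show ?thesis
          using no312[of p x j] below[of x] below[of j] that j p by linarith
      qed
      show "\<not> (\<pi> j < \<pi> x \<and> \<pi> x < \<pi> p)" if "1 \<le> x" "x < p"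
        using high_ge[of x] that j p by (cases "x = 1") auto
      show "\<not> (\<pi> j < \<pi> x \<and> \<pi> x < \<pi> p)" if "j < x" "x \<le> m"
        using no123[of 1 j x] that j by simp
    qed (use p j in auto)
    then show ?thesis using p by simp
  qed
  have low: "\<pi> j + j = \<pi> 1 + 1" if j: "1 < j" "j < p" "\<pi> j < \<pi> 1" for j
  proof -
    have "\<pi> 1 + 1 = \<pi> j + j"
    proof (rule decreasing_run)
      fix x
      show "\<pi> j < \<pi> x \<and> \<pi> x < \<pi> 1" if "1 < x" "x < j"
      proof -
        have "\<pi> x \<noteq> \<pi> j" "\<pi> x \<noteq> \<pi> 1" using that by simp_all
        then show ?thesis
          using no312[of 1 x j] high_ge[of x] that j p by linarith
      qed
      show "\<not> (\<pi> j < \<pi> x \<and> \<pi> x < \<pi> 1)" if "j < x" "x \<le> m"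
        using no312[of 1 j x] that j by simp
    qed (use p j in auto)
    then show ?thesis by simp
  qed
  have late: "\<pi> j + j = q + 1" if j: "p < j" "j \<le> m" "\<pi> j < \<pi> 1" for j
  proof -
    have "\<pi> j + j = \<pi> q + q"
    proof (rule decreasing_run)
      show "j \<le> q"
        using no312[of 1 q j] above[of j] j p q \<open>q \<noteq> 1\<close> by linarith
      show "\<pi> q \<le> \<pi> j" using bounds[of j] j p q by simp
      fix x
      show "\<pi> q < \<pi> x \<and> \<pi> x < \<pi> j" if "j < x" "x < q"
      proof -
        have "\<pi> x \<noteq> \<pi> j" using that by simp
        then show ?thesis
          using no312[of p j x] below[of x] above[of x] that j p q by linarith
      qed
      show "\<not> (\<pi> q < \<pi> x \<and> \<pi> x < \<pi> j)" if "1 \<le> x" "x < j"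
        using no312[of 1 x j] that j by (cases "x = 1") auto
      show "\<not> (\<pi> q < \<pi> x \<and> \<pi> x < \<pi> j)" if "q < x" "x \<le> m"
        using no312[of 1 q x] that j q \<open>q \<noteq> 1\<close> by linarith
    qed (use p q j in auto)
    then show ?thesis using q by simp
  qed
  have "m \<le> 6"
  proof (rule three_sums_imp_le_6)
    fix j assume j: "1 \<le> j" "j \<le> m"
    consider "j = 1" | "1 < j" "\<pi> 1 < \<pi> j" | "1 < j" "\<pi> j < \<pi> 1"
      using j inj[of j 1] by fastforce
    then show "\<pi> j + j = \<pi> 1 + 1 \<or> \<pi> j + j = p + m \<or> \<pi> j + j = q + 1"
    proof cases
      case 3
      moreover have "j \<noteq> p" using bounds[of 1] 3 p assms by auto
      ultimately show ?thesis using low[of j] late[of j] j by linarith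
    qed (use high[of j] j in auto)
  qed
  then show False using assms by simp
qed

text \<open>Reverse-complement is conjugation by \<open>i \<mapsto> m + 1 - i\<close> and so
  preserves the cycle type.\<close>

lemma three_cycles_reverse_complement: "three_cycles m (reverse_complement m \<pi>)"
proof
  show "fixfree_cube_id {1..m} (reverse_complement m \<pi>)"
  proof (rule fixfree_cube_idI)
    fix i assume i: "i \<in> {1..m}"
    define j where "j = m + 1 - i"
    have j: "1 \<le> j" "j \<le> m" "i = m + 1 - j" using i by (auto simp: j_def)
    have rc: "reverse_complement m \<pi> (m + 1 - x) = m + 1 - \<pi> x" if "1 \<le> x" "x \<le> m" for x
      using that by (auto simp: reverse_complement_def)
    show "reverse_complement m \<pi> i \<in> {1..m}"
      using rc[OF j(1,2)] bounds[of j] j by auto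
    show "reverse_complement m \<pi> i \<noteq> i"
      using rc[OF j(1,2)] bounds[of j] no_fix[of j] j by auto
    show "reverse_complement m \<pi> (reverse_complement m \<pi> (reverse_complement m \<pi> i)) = i"
      using rc[of j] rc[of "\<pi> j"] rc[of "\<pi> (\<pi> j)"] bounds[of j] bounds[of "\<pi> j"] j by simp
  qed (auto simp: reverse_complement_def)
qed

end

lemma reverse_complement_less:
  assumes "1 \<le> i" "i \<le> m" "1 \<le> j" "j \<le> m"
    and "reverse_complement m \<pi> i < reverse_complement m \<pi> j"
  shows "\<pi> (m + 1 - j) < \<pi> (m + 1 - i)"
  using assms by (auto simp: reverse_complement_def)

text \<open>Carries the results on 132 and 312, each paired with 123, over to 213 and 231.\<close>

lemma reverse_complement_contains:
  "contains_pattern m (reverse_complement m \<pi>) 3 (one_line [1,2,3]) \<Longrightarrow>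
     contains_pattern m \<pi> 3 (one_line [1,2,3])" (is "?A \<Longrightarrow> ?A'")
  "contains_pattern m (reverse_complement m \<pi>) 3 (one_line [1,3,2]) \<Longrightarrow>
     contains_pattern m \<pi> 3 (one_line [2,1,3])" (is "?B \<Longrightarrow> ?B'")
  "contains_pattern m (reverse_complement m \<pi>) 3 (one_line [3,1,2]) \<Longrightarrow>
     contains_pattern m \<pi> 3 (one_line [2,3,1])" (is "?C \<Longrightarrow> ?C'")
proof -
  note less = reverse_complement_less[of _ m _ \<pi>]
  show ?A' if A: ?A
  proof -
    obtain i j k where ijk: "1 \<le> i" "i < j" "j < k" "k \<le> m"
      "reverse_complement m \<pi> i < reverse_complement m \<pi> j"
      "reverse_complement m \<pi> j < reverse_complement m \<pi> k"
      using A unfolding contains_123 by blast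
    then have "\<pi> (m + 1 - k) < \<pi> (m + 1 - j)" "\<pi> (m + 1 - j) < \<pi> (m + 1 - i)"
      using less[of i j] less[of j k] by simp_all
    moreover have "1 \<le> m + 1 - k" "m + 1 - k < m + 1 - j" "m + 1 - j < m + 1 - i" "m + 1 - i \<le> m"
      using ijk by auto
    ultimately show ?thesis
      unfolding contains_123 by blast
  qed
  show ?B' if B: ?B
  proof -
    obtain i j k where ijk: "1 \<le> i" "i < j" "j < k" "k \<le> m"
      "reverse_complement m \<pi> i < reverse_complement m \<pi> k"
      "reverse_complement m \<pi> k < reverse_complement m \<pi> j"
      using B unfolding contains_132 by blast
    then have "\<pi> (m + 1 - j) < \<pi> (m + 1 - k)" "\<pi> (m + 1 - k) < \<pi> (m + 1 - i)"
      using less[of i k] less[of k j] by simp_all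
    moreover have "1 \<le> m + 1 - k" "m + 1 - k < m + 1 - j" "m + 1 - j < m + 1 - i" "m + 1 - i \<le> m"
      using ijk by auto
    ultimately show ?thesis
      unfolding contains_213 by blast
  qed
  show ?C' if C: ?C
  proof -
    obtain i j k where ijk: "1 \<le> i" "i < j" "j < k" "k \<le> m"
      "reverse_complement m \<pi> j < reverse_complement m \<pi> k"
      "reverse_complement m \<pi> k < reverse_complement m \<pi> i"
      using C unfolding contains_312 by blast
    then have "\<pi> (m + 1 - i) < \<pi> (m + 1 - k)" "\<pi> (m + 1 - k) < \<pi> (m + 1 - j)"
      using less[of j k] less[of k i] by simp_all
    moreover have "1 \<le> m + 1 - k" "m + 1 - k < m + 1 - j" "m + 1 - j < m + 1 - i" "m + 1 - i \<le> m"
      using ijk by auto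
    ultimately show ?thesis
      unfolding contains_231 by blast
  qed
qed

lemma Av_star_empty:
  assumes "6 < m"
  shows "Av_star m (one_line [1,2,3]) (one_line [1,3,2]) = {}"
    and "Av_star m (one_line [1,2,3]) (one_line [2,1,3]) = {}"
    and "Av_star m (one_line [1,2,3]) (one_line [2,3,1]) = {}"
    and "Av_star m (one_line [1,2,3]) (one_line [3,1,2]) = {}"
    and "Av_star m (one_line [1,2,3]) (one_line [3,2,1]) = {}"
    and "Av_star m (one_line [2,3,1]) (one_line [3,1,2]) = {}"
proof -
  have emptyI: "Av_star m \<sigma> \<tau> = {}"
    if "\<And>\<pi>. three_cycles m \<pi> \<Longrightarrow> contains_pattern m \<pi> 3 \<sigma> \<or> contains_pattern m \<pi> 3 \<tau>" for \<sigma> \<tau>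
    using that unfolding Av_star_def S_star_iff three_cycles_def by blast
  show "Av_star m (one_line [1,2,3]) (one_line [1,3,2]) = {}"
    by (rule emptyI) (rule three_cycles.contains_123_or_132[OF _ assms])
  show "Av_star m (one_line [1,2,3]) (one_line [2,1,3]) = {}"
  proof (rule emptyI)
    fix \<pi> assume "three_cycles m \<pi>"
    then have "three_cycles m (reverse_complement m \<pi>)"
      by (rule three_cycles.three_cycles_reverse_complement)
    from three_cycles.contains_123_or_132[OF this assms]
    show "contains_pattern m \<pi> 3 (one_line [1,2,3]) \<or> contains_pattern m \<pi> 3 (one_line [2,1,3])"
      using reverse_complement_contains by blast
  qed
  show "Av_star m (one_line [1,2,3]) (one_line [2,3,1]) = {}"
  proof (rule emptyI)
    fix \<pi> assume "three_cycles m \<pi>"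
    then have "three_cycles m (reverse_complement m \<pi>)"
      by (rule three_cycles.three_cycles_reverse_complement)
    from three_cycles.contains_123_or_312[OF this assms]
    show "contains_pattern m \<pi> 3 (one_line [1,2,3]) \<or> contains_pattern m \<pi> 3 (one_line [2,3,1])"
      using reverse_complement_contains by blast
  qed
  show "Av_star m (one_line [1,2,3]) (one_line [3,1,2]) = {}"
    by (rule emptyI) (rule three_cycles.contains_123_or_312[OF _ assms])
  show "Av_star m (one_line [1,2,3]) (one_line [3,2,1]) = {}"
    by (rule emptyI, rule three_cycles.contains_123_or_321) (use assms in auto)
  show "Av_star m (one_line [2,3,1]) (one_line [3,1,2]) = {}"
    by (rule emptyI, rule three_cycles.contains_231_or_312) (use assms in auto)
qed

section \<open>Symmetry classes of pairs\<close>

lemma permutes_3_cases: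
  assumes "\<sigma> permutes {1..3::nat}"
  shows "\<sigma> = one_line [1,2,3] \<or> \<sigma> = one_line [1,3,2] \<or> \<sigma> = one_line [2,1,3] \<or>
    \<sigma> = one_line [2,3,1] \<or> \<sigma> = one_line [3,1,2] \<or> \<sigma> = one_line [3,2,1]"
proof -
  obtain a b c where abc: "\<sigma> 1 = a" "\<sigma> 2 = b" "\<sigma> 3 = c" by blast
  have "a \<in> {1..3}" "b \<in> {1..3}" "c \<in> {1..3}"
    using permutes_in_image[OF assms, of 1] permutes_in_image[OF assms, of 2]
      permutes_in_image[OF assms, of 3] unfolding abc by simp_all
  then have range: "a = 1 \<or> a = 2 \<or> a = 3" "b = 1 \<or> b = 2 \<or> b = 3" "c = 1 \<or> c = 2 \<or> c = 3"
    unfolding atLeastAtMost_1_3 by simp_all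
  have inj: "\<sigma> i = \<sigma> j \<longleftrightarrow> i = j" for i j
    using permutes_inj[OF assms] by (rule inj_eq)
  have neq: "a \<noteq> b" "a \<noteq> c" "b \<noteq> c"
    using inj[of 1 2] inj[of 1 3] inj[of 2 3] unfolding abc by simp_all
  have "\<sigma> i = one_line [a, b, c] i" for i
    using permutes_not_in[OF assms, of i] abc unfolding one_line_3 atLeastAtMost_1_3 by auto
  then have "\<sigma> = one_line [a, b, c]" by (rule ext)
  moreover have "[a,b,c] = [1,2,3] \<or> [a,b,c] = [1,3,2] \<or> [a,b,c] = [2,1,3] \<or>
      [a,b,c] = [2,3,1] \<or> [a,b,c] = [3,1,2] \<or> [a,b,c] = [3,2,1]"
    using range neq by (elim disjE) simp_all
  ultimately show ?thesis by (elim disjE) simp_all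
qed

lemma inv_one_line:
  "inv (one_line [1,3,2]) = one_line [1,3,2]"
  "inv (one_line [2,1,3]) = one_line [2,1,3]"
  "inv (one_line [2,3,1]) = one_line [3,1,2]"
  "inv (one_line [3,2,1]) = one_line [3,2,1]"
  by (rule inv_unique_comp; auto simp: fun_eq_iff one_line_3)+

lemma reverse_complement_one_line:
  "reverse_complement 3 (one_line [a,b,c]) = one_line [4 - c, 4 - b, 4 - a]"
  unfolding fun_eq_iff reverse_complement_def one_line_3 atLeastAtMost_1_3 by auto

lemma Av_star_commute: "Av_star m \<sigma> \<tau> = Av_star m \<tau> \<sigma>"
  by (auto simp: Av_star_def)

theorem theorem5p2:
  shows "(\<forall>n\<ge>1.
            card (Av_star (3 * n) (one_line [1,3,2]) (one_line [2,1,3])) = 2 \<and>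
            card (Av_star (3 * n) (one_line [1,3,2]) (one_line [3,2,1])) = 2 \<and>
            card (Av_star (3 * n) (one_line [1,3,2]) (one_line [2,3,1])) = 1 \<and>
            card (Av_star (3 * n) (one_line [2,3,1]) (one_line [3,2,1])) = 1) \<and>
         (\<forall>\<sigma> \<tau>. \<sigma> permutes {1..3} \<and> \<tau> permutes {1..3} \<and> \<sigma> \<noteq> \<tau> \<and>
            \<not> (\<exists>g\<in>symmetries 3.
                 {\<sigma>, \<tau>} = g ` {one_line [1,3,2], one_line [2,1,3]} \<or>
                 {\<sigma>, \<tau>} = g ` {one_line [1,3,2], one_line [3,2,1]} \<or>
                 {\<sigma>, \<tau>} = g ` {one_line [1,3,2], one_line [2,3,1]} \<or>
                 {\<sigma>, \<tau>} = g ` {one_line [2,3,1], one_line [3,2,1]}) \<longrightarrow>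
            (\<forall>n>2. card (Av_star (3 * n) \<sigma> \<tau>) = 0))"
proof (intro conjI allI impI)
  fix n :: nat assume "1 \<le> n"
  then show "card (Av_star (3 * n) (one_line [1,3,2]) (one_line [2,1,3])) = 2"
    "card (Av_star (3 * n) (one_line [1,3,2]) (one_line [3,2,1])) = 2"
    "card (Av_star (3 * n) (one_line [1,3,2]) (one_line [2,3,1])) = 1"
    "card (Av_star (3 * n) (one_line [2,3,1]) (one_line [3,2,1])) = 1"
    unfolding Av_star_132_213[OF \<open>1 \<le> n\<close>] Av_star_132_321[OF \<open>1 \<le> n\<close>]
      Av_star_132_231[OF \<open>1 \<le> n\<close>] Av_star_231_321
    by (simp_all only: card_rotations) simp_all
next
  fix \<sigma> \<tau> :: "nat \<Rightarrow> nat" and n :: nat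
  define listed where "listed P \<longleftrightarrow> (\<exists>g\<in>symmetries 3.
      P = g ` {one_line [1,3,2], one_line [2,1,3]} \<or>
      P = g ` {one_line [1,3,2], one_line [3,2,1]} \<or>
      P = g ` {one_line [1,3,2], one_line [2,3,1]} \<or>
      P = g ` {one_line [2,3,1], one_line [3,2,1]})" for P
  \<comment> \<open>Being symmetric in the two patterns, this halves the thirty ordered pairs to
    fifteen.\<close>
  define settled where "settled \<sigma> \<tau> \<longleftrightarrow> listed {\<sigma>, \<tau>} \<or> card (Av_star (3 * n) \<sigma> \<tau>) = 0" for \<sigma> \<tau>
  assume "\<sigma> permutes {1..3} \<and> \<tau> permutes {1..3} \<and> \<sigma> \<noteq> \<tau> \<and>
            \<not> (\<exists>g\<in>symmetries 3.
                 {\<sigma>, \<tau>} = g ` {one_line [1,3,2], one_line [2,1,3]} \<or>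
                 {\<sigma>, \<tau>} = g ` {one_line [1,3,2], one_line [3,2,1]} \<or>
                 {\<sigma>, \<tau>} = g ` {one_line [1,3,2], one_line [2,3,1]} \<or>
                 {\<sigma>, \<tau>} = g ` {one_line [2,3,1], one_line [3,2,1]})"
  then have perms: "\<sigma> permutes {1..3}" "\<tau> permutes {1..3}" and "\<sigma> \<noteq> \<tau>" "\<not> listed {\<sigma>, \<tau>}"
    unfolding listed_def by blast+
  assume "2 < n"
  then have "6 < 3 * n" by simp
  note empty = Av_star_empty[OF this]
  have images: "listed (g ` {one_line [1,3,2], one_line [2,1,3]})"
    "listed (g ` {one_line [1,3,2], one_line [3,2,1]})"
    "listed (g ` {one_line [1,3,2], one_line [2,3,1]})"
    "listed (g ` {one_line [2,3,1], one_line [3,2,1]})"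
    if "g \<in> symmetries 3" for g
    using that unfolding listed_def by blast+
  have inverse: "inv \<circ> id \<in> symmetries 3"
    by (intro symmetries.intros)
  have rc: "reverse_complement 3 \<circ> id \<in> symmetries 3"
    by (intro symmetries.intros)
  \<comment> \<open>On permutations the two operations are commuting involutions, so with the
    identity there are four symmetries to apply.\<close>
  have rc_inverse: "reverse_complement 3 \<circ> (inv \<circ> id) \<in> symmetries 3"
    by (intro symmetries.intros)
  note apply_symmetry = image_insert image_empty o_apply id_apply inv_one_line
    reverse_complement_one_line
  \<comment> \<open>The orbits of the four given pairs have sizes 1, 2, 4 and 2. The other six of
    the fifteen pairs are those of \<open>Av_star_empty\<close>.\<close>
  have listed_pairs:
    "listed {one_line [1,3,2], one_line [2,1,3]}" "listed {one_line [1,3,2], one_line [3,2,1]}"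
    "listed {one_line [1,3,2], one_line [2,3,1]}" "listed {one_line [2,3,1], one_line [3,2,1]}"
    "listed {one_line [1,3,2], one_line [3,1,2]}" "listed {one_line [3,1,2], one_line [3,2,1]}"
    "listed {one_line [2,1,3], one_line [3,2,1]}" "listed {one_line [2,1,3], one_line [3,1,2]}"
    "listed {one_line [2,1,3], one_line [2,3,1]}"
    using images[OF symmetries.sym_id] images[OF inverse, unfolded apply_symmetry]
      images[OF rc, unfolded apply_symmetry] images[OF rc_inverse, unfolded apply_symmetry]
    by simp_all
  have commute: "settled \<tau> \<sigma>" if "settled \<sigma> \<tau>" for \<sigma> \<tau>
    using that unfolding settled_def by (simp add: insert_commute Av_star_commute)
  have settled_pairs:
    "settled (one_line [1,3,2]) (one_line [2,1,3])" "settled (one_line [1,3,2]) (one_line [3,2,1])"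
    "settled (one_line [1,3,2]) (one_line [2,3,1])" "settled (one_line [2,3,1]) (one_line [3,2,1])"
    "settled (one_line [1,3,2]) (one_line [3,1,2])" "settled (one_line [3,1,2]) (one_line [3,2,1])"
    "settled (one_line [2,1,3]) (one_line [3,2,1])" "settled (one_line [2,1,3]) (one_line [3,1,2])"
    "settled (one_line [2,1,3]) (one_line [2,3,1])" "settled (one_line [1,2,3]) (one_line [1,3,2])"
    "settled (one_line [1,2,3]) (one_line [2,1,3])" "settled (one_line [1,2,3]) (one_line [2,3,1])"
    "settled (one_line [1,2,3]) (one_line [3,1,2])" "settled (one_line [1,2,3]) (one_line [3,2,1])"
    "settled (one_line [2,3,1]) (one_line [3,1,2])"
    unfolding settled_def empty by (simp_all only: listed_pairs card.empty simp_thms)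
  have "settled \<sigma> \<tau>"
    using permutes_3_cases[OF perms(1)] permutes_3_cases[OF perms(2)] \<open>\<sigma> \<noteq> \<tau>\<close>
    by (elim disjE; simp only: simp_thms settled_pairs settled_pairs[THEN commute])
  then show "card (Av_star (3 * n) \<sigma> \<tau>) = 0"
    using \<open>\<not> listed {\<sigma>, \<tau>}\<close> unfolding settled_def by blast
qed

end
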